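(* Let $X_1,\ldots,X_n$ and $Y_1,\ldots,Y_n$ be independent symmetric random vectors with values in a real separable Banach space $E$, and let $\kappa,\lambda\geq 1$. Suppose that $X_i$ is $(\kappa,\lambda)$-dominated by $Y_i$ for each $i=1,\ldots,n$. Then for every $0<\alpha\leq 1$ the sum $X_1+\ldots+X_n$ is $\bigl(16\alpha^{-1}\lceil\kappa\rceil,\,(1+\alpha)\lceil\kappa\rceil\lambda\bigr)$-dominated by the sum $Y_1+\ldots+Y_n$.
   Context: A random vector $X$ is symmetric if $X$ and $-X$ have the same distribution. For symmetric random vectors $X,Y$ with values in a real separable Banach space $E$ and constants $\kappa,\lambda\geq 1$, we say that $X$ is $(\kappa,\lambda)$-dominated by $Y$ if for every closed, convex and symmetric ($K=-K$) set $K\subset E$ we have $\mathbb{P}(X\notin K)\leq \kappa\,\mathbb{P}(\lambda Y\notin K)$. Equivalently: for every continuous norm $\|\cdot\|$ on $E$, $\mathbb{P}(\|X\|>1)\leq\kappa\,\mathbb{P}(\lambda\|Y\|>1)$. Here $\lceil\kappa\rceil$ is the smallest integer not less than $\kappa$. *)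

theory Defs
  imports "HOL-Probability.Probability"
begin

definition symmetric_rv :: "'w measure \<Rightarrow> ('w \<Rightarrow> 'a::real_normed_vector) \<Rightarrow> bool" where
  "symmetric_rv M X \<longleftrightarrow>
     X \<in> borel_measurable M \<and> distr M borel X = distr M borel (\<lambda>\<omega>. - X \<omega>)"

text \<open>The notion is meant for symmetric random vectors and constants at least 1; these
  conditions are not part of the definition and have to be assumed where it is used.\<close>

definition dominated ::
  "'w measure \<Rightarrow> real \<Rightarrow> real \<Rightarrow> ('w \<Rightarrow> 'a::real_normed_vector) \<Rightarrow> ('w \<Rightarrow> 'a) \<Rightarrow> bool" where
  "dominated M \<kappa> l X Y \<longleftrightarrow>
     (\<forall>K. closed K \<and> convex K \<and> uminus ` K = K \<longrightarrow>
        measure M {\<omega> \<in> space M. X \<omega> \<notin> K} \<le> \<kappa> * measure M {\<omega> \<in> space M. l *\<^sub>R Y \<omega> \<notin> K})"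

end

theory Submission
  imports Defs
begin

text \<open>
  \<^emph>\<open>Reductions.\<close> A closed convex symmetric set is the decreasing intersection of its thickenings, each of
  which is a neighbourhood of \<open>0\<close> and hence the unit ball of a continuous seminorm \<open>N\<close>
  (\<open>seminorm_of_convex_neighbourhood\<close>). Only the laws \<open>\<mu>\<^sub>i\<close> of \<open>X\<^sub>i\<close> and \<open>\<nu>\<^sub>i\<close> of \<open>l Y\<^sub>i\<close> matter, so everything
  takes place on products of these laws. To remove the factor \<open>m = \<lceil>\<kappa>\<rceil>\<close>, cut each \<open>X\<^sub>i\<close> into \<open>m\<close> parts by
  choosing uniformly at random the part that receives the whole of \<open>X\<^sub>i\<close>, the others being \<open>0\<close>. A single
  part leaves a set containing \<open>0\<close> with a probability \<open>m\<close> times smaller than \<open>X\<^sub>i\<close> does, so it is dominated by \<open>\<nu>\<^sub>i\<close> with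
  constants \<open>1\<close> and \<open>1\<close>; and if \<open>N\<close> of the full sum exceeds \<open>m (1 + \<alpha>)\<close>, then \<open>N\<close> of the sum of the
  \<open>j\<close>-th parts exceeds \<open>1 + \<alpha>\<close> for some \<open>j\<close> (\<open>domination_by_thinning\<close>). This costs \<open>m\<close> in both constants.

  \<^emph>\<open>Constants one.\<close> Domination with constants \<open>1\<close> compares the expectations of all symmetric
  quasi-convex functions of one variable, by the layer-cake formula. Tails of a sum are not expectations
  of convex functions, but the excess \<open>(N - 1)\<^sup>+\<close> is one. Write \<open>Y\<^sub>i\<close>
  for \<open>l Y\<^sub>i\<close>, \<open>X''\<^sub>i\<close>, \<open>Y''\<^sub>i\<close> for the variables truncated to \<open>0\<close>
  outside the unit ball of \<open>N\<close>, \<open>q\<^sub>i\<close> for the probability \<open>P(N(Y\<^sub>i) > 1)\<close>, \<open>Q\<close> for the sum of the \<open>q\<^sub>i\<close>, and \<open>p\<close> for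
  \<open>P(N(\<Sum>Y\<^sub>i) > 1)\<close>. Replacing one \<open>X''\<^sub>i\<close> by \<open>Y''\<^sub>i\<close> inside a convex symmetric function that is \<open>1\<close>-Lipschitz
  for \<open>N\<close> costs at most \<open>q\<^sub>i\<close> (\<open>replace_one_summand\<close>), so that
  \<open>E (N(\<Sum>X''\<^sub>i) - 1)\<^sup>+ \<le> D\<close> with \<open>D = E (N(\<Sum>Y''\<^sub>i) - 1)\<^sup>+ + Q\<close>.

  The quantity \<open>D\<close> is controlled by stopping the partial sums of the \<open>Y\<^sub>i\<close> at the first time at which either
  a summand or the partial sum leaves the unit ball. By reflection this happens with
  probability at most \<open>2 p\<close>, and what accumulates afterwards is in expectation at most
  \<open>1 + E N(\<Sum>Y''\<^sub>i) + Q \<le> 2 + D\<close> (\<open>excess_before_exit\<close>). So \<open>D \<le> 2 p (2 + D)\<close>, which gives \<open>D \<le> 8 p\<close> when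
  \<open>p \<le> 1/4\<close>; for larger \<open>p\<close> the claim is trivial. Finally \<open>N(\<Sum>X\<^sub>i) > 1 + \<alpha>\<close> forces \<open>N(X\<^sub>i) > 1\<close> for some \<open>i\<close>, which has probability at most
  \<open>Q \<le> D\<close>, or \<open>(N(\<Sum>X''\<^sub>i) - 1)\<^sup>+ > \<alpha>\<close>, which by Markov has probability at most \<open>D / \<alpha>\<close>. The total is at
  most \<open>2 D / \<alpha> \<le> 16 p / \<alpha>\<close> (\<open>unit_domination\<close>).
\<close>

section \<open>Expectations over sums of independent summands\<close>

text \<open>
  The summands are integrated against the product of their laws and not against a common probability
  space, because summands with different laws have to be exchanged one at a time and the two given
  families of random vectors need not be independent of each other. The map \<open>h\<close> is a
  modification of the summands, such as truncation, that leaves the product measure unchanged.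
\<close>

definition sum_expectation ::
  "('i \<Rightarrow> 'b measure) \<Rightarrow> ('b \<Rightarrow> 'a::{banach, second_countable_topology}) \<Rightarrow> 'i set \<Rightarrow> ('a \<Rightarrow> ennreal) \<Rightarrow> ennreal" where
  "sum_expectation L h I F = (\<integral>\<^sup>+x. F (\<Sum>i\<in>I. h (x i)) \<partial>Pi\<^sub>M I L)"

lemma sum_expectation_empty [simp]: "sum_expectation L h {} F = F 0"
  unfolding sum_expectation_def PiM_empty
  by (simp add: nn_integral_count_space_finite)

lemma sum_expectation_mono:
  assumes "\<And>z. F z \<le> G z"
  shows "sum_expectation L h I F \<le> sum_expectation L h I G"
  unfolding sum_expectation_def using assms by (intro nn_integral_mono) auto

locale summand_laws =
  fixes L :: "'i \<Rightarrow> 'b measure" and h :: "'b \<Rightarrow> 'a::{banach, second_countable_topology}"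
  assumes prob_law: "\<And>i. prob_space (L i)"
    and measurable_summand [measurable]: "\<And>i. h \<in> borel_measurable (L i)"
begin

lemma prob_space_product: "prob_space (Pi\<^sub>M I L)"
  using prob_law by (intro prob_space_PiM)

lemma measurable_partial_sum [measurable]:
  "(\<lambda>x. \<Sum>i\<in>I. h (x i)) \<in> borel_measurable (Pi\<^sub>M I L)"
  by measurable

lemma borel_measurable_sum_expectation:
  assumes [measurable]: "(\<lambda>(y, z). F y z) \<in> borel_measurable (R \<Otimes>\<^sub>M borel)"
  shows "(\<lambda>y. sum_expectation L h I (F y)) \<in> borel_measurable R"
proof -
  interpret P: prob_space "Pi\<^sub>M I L" by (rule prob_space_product)
  show ?thesis unfolding sum_expectation_def by measurable
qed

lemma sum_expectation_add:
  assumes [measurable]: "F \<in> borel_measurable borel" "G \<in> borel_measurable borel"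
  shows "sum_expectation L h I (\<lambda>z. F z + G z) = sum_expectation L h I F + sum_expectation L h I G"
  unfolding sum_expectation_def by (intro nn_integral_add) measurable

lemma sum_expectation_const: "sum_expectation L h I (\<lambda>z. c) = c"
proof -
  interpret P: prob_space "Pi\<^sub>M I L" by (rule prob_space_product)
  show ?thesis unfolding sum_expectation_def by (simp add: P.emeasure_space_1)
qed

lemma sum_expectation_swap:
  assumes R: "prob_space R"
    and [measurable]: "(\<lambda>(y, z). F y z) \<in> borel_measurable (R \<Otimes>\<^sub>M borel)"
  shows "(\<integral>\<^sup>+y. sum_expectation L h I (F y) \<partial>R) = sum_expectation L h I (\<lambda>z. \<integral>\<^sup>+y. F y z \<partial>R)"
proof -
  interpret P: prob_space "Pi\<^sub>M I L" by (rule prob_space_product)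
  interpret R: prob_space R by (rule R)
  interpret PR: pair_sigma_finite "Pi\<^sub>M I L" R ..
  show ?thesis unfolding sum_expectation_def by (intro PR.Fubini') measurable
qed

lemma sum_expectation_insert:
  assumes I: "finite I" "i \<notin> I" and [measurable]: "F \<in> borel_measurable borel"
  shows "sum_expectation L h (insert i I) F =
    (\<integral>\<^sup>+y. sum_expectation L h I (\<lambda>z. F (h y + z)) \<partial>L i)"
proof -
  interpret S: product_sigma_finite L
    using prob_law by (simp add: product_sigma_finite_def prob_space_imp_sigma_finite)
  have *: "(\<Sum>j\<in>insert i I. h ((x(i := y)) j)) = h y + (\<Sum>j\<in>I. h (x j))" for x y
  proof -
    have "(\<Sum>j\<in>I. h ((x(i := y)) j)) = (\<Sum>j\<in>I. h (x j))"
      using I by (intro sum.cong) auto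
    then show ?thesis using I by simp
  qed
  show ?thesis unfolding sum_expectation_def
    by (subst S.product_nn_integral_insert_rev[OF I]) (measurable, simp only: *)
qed

end

lemma sum_expectation_distr:
  assumes "finite I" "summand_laws R (\<lambda>x. h (k x))"
    and k: "\<And>i. k \<in> measurable (R i) B" and h: "h \<in> borel_measurable B"
    and F: "F \<in> borel_measurable borel"
  shows "sum_expectation (\<lambda>i. distr (R i) B k) h I F = sum_expectation R (\<lambda>x. h (k x)) I F"
proof -
  interpret R: summand_laws R "\<lambda>x. h (k x)" by fact
  interpret D: summand_laws "\<lambda>i. distr (R i) B k" h
    using prob_space.prob_space_distr[OF R.prob_law k] h by (intro summand_laws.intro) simp_all
  note [measurable] = k h
  show ?thesis using assms(1) F
  proof (induction I arbitrary: F)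
    case (insert i I)
    note [measurable] = insert.prems
    have "sum_expectation (\<lambda>i. distr (R i) B k) h (insert i I) F
      = (\<integral>\<^sup>+y. sum_expectation (\<lambda>i. distr (R i) B k) h I (\<lambda>z. F (h y + z)) \<partial>distr (R i) B k)"
      using insert by (intro D.sum_expectation_insert)
    also have "\<dots> = (\<integral>\<^sup>+y. sum_expectation (\<lambda>i. distr (R i) B k) h I (\<lambda>z. F (h (k y) + z)) \<partial>R i)"
      by (intro nn_integral_distr D.borel_measurable_sum_expectation) measurable
    also have "\<dots> = (\<integral>\<^sup>+y. sum_expectation R (\<lambda>x. h (k x)) I (\<lambda>z. F (h (k y) + z)) \<partial>R i)"
      by (intro nn_integral_cong insert.IH) measurable
    also have "\<dots> = sum_expectation R (\<lambda>x. h (k x)) (insert i I) F"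
      using insert by (intro R.sum_expectation_insert[symmetric])
    finally show ?case .
  qed simp
qed

definition symmetric_law :: "'a::{banach, second_countable_topology} measure \<Rightarrow> bool" where
  "symmetric_law L \<longleftrightarrow> prob_space L \<and> sets L = sets borel \<and> distr L borel uminus = L"

lemma measurable_symmetric_law: "symmetric_law L \<Longrightarrow> borel_measurable L = borel_measurable borel"
  unfolding symmetric_law_def by (intro measurable_cong_sets) auto

lemma symmetric_law_reflect:
  assumes L: "symmetric_law L" and [measurable]: "F \<in> borel_measurable borel"
  shows "(\<integral>\<^sup>+y. F (- y) \<partial>L) = (\<integral>\<^sup>+y. F y \<partial>L)"
proof -
  have [measurable_cong]: "sets L = sets borel" using L by (simp add: symmetric_law_def)
  have "(\<integral>\<^sup>+y. F y \<partial>L) = (\<integral>\<^sup>+y. F y \<partial>distr L borel uminus)"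
    using L by (simp add: symmetric_law_def)
  also have "\<dots> = (\<integral>\<^sup>+y. F (- y) \<partial>L)" by (intro nn_integral_distr) measurable
  finally show ?thesis by simp
qed

text \<open>
  Modifications of the summands have to be odd, so that the modified summands are again symmetric.
\<close>

locale symmetric_laws =
  fixes L :: "'i \<Rightarrow> 'a::{banach, second_countable_topology} measure" and h :: "'a \<Rightarrow> 'a"
  assumes symmetric: "\<And>i. symmetric_law (L i)"
    and borel_summand [measurable]: "h \<in> borel_measurable borel"
    and odd_summand: "\<And>y. h (- y) = - h y"
begin

lemma sets_law [measurable_cong]: "sets (L i) = sets borel"
  using symmetric[of i] by (simp add: symmetric_law_def)

sublocale summand_laws L h
  using symmetric
  by (intro summand_laws.intro) (simp_all add: symmetric_law_def measurable_symmetric_law)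

lemma sum_expectation_reflect:
  assumes "finite I" "F \<in> borel_measurable borel"
  shows "sum_expectation L h I (\<lambda>z. F (- z)) = sum_expectation L h I F"
  using assms
proof (induction I arbitrary: F)
  case (insert i I)
  note [measurable] = insert.prems
  have "sum_expectation L h (insert i I) (\<lambda>z. F (- z))
      = (\<integral>\<^sup>+y. sum_expectation L h I (\<lambda>z. F (- (h y + z))) \<partial>L i)"
    using insert by (intro sum_expectation_insert) measurable
  also have "\<dots> = (\<integral>\<^sup>+y. sum_expectation L h I (\<lambda>z. F (h (- y) + z)) \<partial>L i)"
  proof (intro nn_integral_cong)
    fix y
    have "sum_expectation L h I (\<lambda>z. F (- h y + - z)) = sum_expectation L h I (\<lambda>z. F (- h y + z))"
      by (rule insert.IH) measurable
    then show "sum_expectation L h I (\<lambda>z. F (- (h y + z))) = sum_expectation L h I (\<lambda>z. F (h (- y) + z))"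
      by (simp add: odd_summand)
  qed
  also have "\<dots> = (\<integral>\<^sup>+y. sum_expectation L h I (\<lambda>z. F (h y + z)) \<partial>L i)"
    by (rule symmetric_law_reflect[OF symmetric])
      (intro borel_measurable_sum_expectation, measurable)
  also have "\<dots> = sum_expectation L h (insert i I) F"
    using insert by (intro sum_expectation_insert[symmetric])
  finally show ?case .
qed simp

end

text \<open>
  Both sides are integrals of the tails over the level \<open>t\<close>, by the layer-cake formula. This turns
  domination on sublevel sets into domination of expectations.
\<close>

lemma nn_integral_mono_tails:
  fixes \<mu> \<nu> :: "'b measure" and \<psi> :: "'b \<Rightarrow> ennreal"
  assumes "sigma_finite_measure \<mu>" "sigma_finite_measure \<nu>"
    and [measurable]: "\<psi> \<in> borel_measurable \<mu>" "\<psi> \<in> borel_measurable \<nu>"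
    and tails: "\<And>t. 0 \<le> t \<Longrightarrow> emeasure \<mu> {x \<in> space \<mu>. ennreal t < \<psi> x} \<le> emeasure \<nu> {x \<in> space \<nu>. ennreal t < \<psi> x}"
  shows "(\<integral>\<^sup>+x. \<psi> x \<partial>\<mu>) \<le> (\<integral>\<^sup>+x. \<psi> x \<partial>\<nu>)"
proof -
  have layers: "u = (\<integral>\<^sup>+t. indicator {t. 0 \<le> t \<and> ennreal t < u} t \<partial>lborel)" for u :: ennreal
  proof (cases u)
    case (real r)
    then have "{t. 0 \<le> t \<and> ennreal t < u} = {0..<r}" by (auto simp: ennreal_less_iff)
    with real show ?thesis by simp
  next
    case top
    then have *: "{t. 0 \<le> t \<and> ennreal t < u} = {0..}" by auto
    have "of_nat n \<le> emeasure lborel {0::real..}" for n :: nat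
      using emeasure_mono[of "{0..real n}" "{0..}" lborel] by (auto simp: ennreal_of_nat_eq_real_of_nat)
    then have "(SUP n. of_nat n) \<le> emeasure lborel {0::real..}" by (rule SUP_least)
    with top * show ?thesis by (simp add: ennreal_SUP_of_nat_eq_top top_unique)
  qed
  have layer_cake: "(\<integral>\<^sup>+x. \<psi> x \<partial>L) =
      (\<integral>\<^sup>+t. indicator {0..} t * emeasure L {x \<in> space L. ennreal t < \<psi> x} \<partial>lborel)"
    if "sigma_finite_measure L" and [measurable]: "\<psi> \<in> borel_measurable L" for L
  proof -
    interpret L: sigma_finite_measure L by fact
    interpret P: pair_sigma_finite lborel L ..
    have "(\<integral>\<^sup>+x. \<psi> x \<partial>L) = (\<integral>\<^sup>+x. (\<integral>\<^sup>+t. indicator {t. 0 \<le> t \<and> ennreal t < \<psi> x} t \<partial>lborel) \<partial>L)"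
      using layers by simp
    also have "\<dots> = (\<integral>\<^sup>+t. (\<integral>\<^sup>+x. indicator {t. 0 \<le> t \<and> ennreal t < \<psi> x} t \<partial>L) \<partial>lborel)"
      by (intro P.Fubini') measurable
    also have "\<dots> = (\<integral>\<^sup>+t. (\<integral>\<^sup>+x. indicator {0..} t * indicator {x \<in> space L. ennreal t < \<psi> x} x \<partial>L) \<partial>lborel)"
      by (intro nn_integral_cong) (auto simp: indicator_def)
    also have "\<dots> = (\<integral>\<^sup>+t. indicator {0..} t * emeasure L {x \<in> space L. ennreal t < \<psi> x} \<partial>lborel)"
      by (intro nn_integral_cong) (simp add: nn_integral_cmult)
    finally show ?thesis .
  qed
  show ?thesis unfolding layer_cake[OF assms(1,3)] layer_cake[OF assms(2,4)]
    by (intro nn_integral_mono) (simp add: tails indicator_def)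
qed

section \<open>Truncation and first exit from the unit ball\<close>

locale continuous_seminorm =
  fixes N :: "'a::{banach, second_countable_topology} \<Rightarrow> real"
  assumes triangle: "\<And>x y. N (x + y) \<le> N x + N y"
    and homogeneous: "\<And>c x. N (c *\<^sub>R x) = \<bar>c\<bar> * N x"
    and bounded: "\<exists>C. \<forall>x. N x \<le> C * norm x"
begin

lemma N_zero [simp]: "N 0 = 0"
  using homogeneous[of 0 0] by simp

lemma N_minus [simp]: "N (- x) = N x"
  using homogeneous[of "-1" x] by simp

lemma N_nonneg [simp]: "0 \<le> N x"
  using triangle[of x "- x"] by simp

lemma N_sum_le: "N (\<Sum>i\<in>I. x i) \<le> (\<Sum>i\<in>I. N (x i))"
  by (induction I rule: infinite_finite_induct) (auto intro: order_trans[OF triangle])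

lemma continuous_on_N [continuous_intros]: "continuous_on UNIV N"
proof -
  obtain C where C: "\<And>x. N x \<le> C * norm x" using bounded by blast
  have "N x \<le> N y + C * norm (x - y)" for x y
    using triangle[of "x - y" y] C[of "x - y"] by simp
  then have "\<bar>N x - N y\<bar> \<le> max 0 C * norm (x - y)" for x y
    using mult_right_mono[of C "max 0 C" "norm (x - y)"] 
    by (smt (verit, best) max.cobounded2 norm_ge_zero norm_minus_commute)
  then have "(max 0 C)-lipschitz_on UNIV N"
    by (intro lipschitz_onI) (auto simp: dist_norm)
  then show ?thesis by (rule lipschitz_on_continuous_on)
qed

lemma borel_measurable_N [measurable]: "N \<in> borel_measurable borel"
  using continuous_on_N by (rule borel_measurable_continuous_onI)

definition trunc :: "'a \<Rightarrow> 'a" where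
  "trunc y = (if N y \<le> 1 then y else 0)"

definition far :: "'a set" where
  "far = {y. 1 < N y}"

definition excess :: "'a \<Rightarrow> ennreal" where
  "excess z = ennreal (N z - 1)"

lemma far_borel [measurable]: "far \<in> sets borel"
  unfolding far_def by measurable

lemma trunc_borel [measurable]: "trunc \<in> borel_measurable borel"
  unfolding trunc_def by measurable

lemma excess_borel [measurable]: "excess \<in> borel_measurable borel"
  unfolding excess_def by measurable

lemma N_trunc_le: "N (trunc y) \<le> 1"
  by (simp add: trunc_def)

lemma trunc_minus: "trunc (- y) = - trunc y"
  by (simp add: trunc_def)

lemma far_minus [simp]: "- y \<in> far \<longleftrightarrow> y \<in> far"
  by (simp add: far_def)

text \<open>
  The form of Levy's reflection principle used below: \<open>w\<close> is the midpoint of \<open>w + z\<close> and \<open>w - z\<close>, and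
  for symmetric \<open>z\<close> these two points have the same distribution.
\<close>

lemma far_either: "indicator far w \<le> (indicator far (w + z) + indicator far (w - z) :: ennreal)"
proof -
  have "2 * N w \<le> N (w + z) + N (w - z)"
    using triangle[of "w + z" "w - z"] homogeneous[of 2 w] by (simp add: scaleR_2)
  then show ?thesis by (auto simp: far_def indicator_def)
qed

lemma symmetric_laws_trunc: "(\<And>i. symmetric_law (L i)) \<Longrightarrow> symmetric_laws L trunc"
  by unfold_locales (auto simp: trunc_minus)

lemma symmetric_laws_id: "(\<And>i. symmetric_law (L i)) \<Longrightarrow> symmetric_laws L (\<lambda>x. x)"
  by unfold_locales auto

text \<open>
  Jensen's inequality: a sum without its \<open>i\<close>-th summand is the conditional mean of the full sum.
\<close>

lemma sum_expectation_N_insert: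
  assumes L: "\<And>i. symmetric_law (L i)" and I: "finite I" "i \<notin> I"
  shows "sum_expectation L trunc I N \<le> sum_expectation L trunc (insert i I) N"
proof -
  interpret symmetric_laws L trunc using L by (rule symmetric_laws_trunc)
  interpret Li: prob_space "L i" by (rule prob_law)
  have "N z \<le> (\<integral>\<^sup>+y. N (trunc y + z) \<partial>L i)" for z
  proof -
    have "2 * ennreal (N z) = (\<integral>\<^sup>+y. 2 * ennreal (N z) \<partial>L i)"
      by (simp add: Li.emeasure_space_1)
    also have "\<dots> \<le> (\<integral>\<^sup>+y. N (trunc y + z) + N (trunc (- y) + z) \<partial>L i)"
    proof (intro nn_integral_mono)
      fix y
      have "2 * N z \<le> N (trunc y + z) + N (trunc (- y) + z)"
        using triangle[of "trunc y + z" "- trunc y + z"] homogeneous[of 2 z]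
        by (simp add: scaleR_2 trunc_minus)
      then show "2 * ennreal (N z) \<le> ennreal (N (trunc y + z) + N (trunc (- y) + z))"
        by (metis ennreal_leI ennreal_mult' ennreal_numeral zero_le_numeral)
    qed
    also have "\<dots> = (\<integral>\<^sup>+y. N (trunc y + z) \<partial>L i) + (\<integral>\<^sup>+y. N (trunc (- y) + z) \<partial>L i)"
      by (simp add: ennreal_plus nn_integral_add)
    also have "(\<integral>\<^sup>+y. N (trunc (- y) + z) \<partial>L i) = (\<integral>\<^sup>+y. N (trunc y + z) \<partial>L i)"
      by (rule symmetric_law_reflect[OF L]) measurable
    finally have "2 * ennreal (N z) \<le> 2 * (\<integral>\<^sup>+y. N (trunc y + z) \<partial>L i)"
      by (simp add: mult_2)
    then show ?thesis by (simp add: ennreal_mult_le_mult_iff)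
  qed
  then have "sum_expectation L trunc I N \<le> sum_expectation L trunc I (\<lambda>z. \<integral>\<^sup>+y. N (trunc y + z) \<partial>L i)"
    by (rule sum_expectation_mono)
  also have "\<dots> = sum_expectation L trunc (insert i I) N"
    by (subst sum_expectation_insert[OF I], measurable, rule sum_expectation_swap[symmetric, OF prob_law], measurable)
  finally show ?thesis .
qed

lemma excess_add_le: "N s \<le> 1 + c \<Longrightarrow> 0 \<le> c \<Longrightarrow> excess (s + z) \<le> ennreal c + ennreal (N z)"
  unfolding excess_def using triangle[of s z]
  by (simp add: ennreal_plus[symmetric] ennreal_leI del: ennreal_plus)

text \<open>
  The starting point \<open>s\<close> is the current partial sum, and \<open>I\<close> indexes the summands that are still to
  come; induction on \<open>I\<close> replaces an explicit stopping time. As long as neither the next summand \<open>y\<close> nor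
  \<open>s + y\<close> leaves the unit ball, the walk goes on. Once one of them leaves it, the left-hand side is at
  most \<open>M\<close>: one for the exit itself, the expected norm of the remaining truncated sum, and the expected
  number of further jumps; and by reflection the untruncated sum is then outside the ball with
  probability at least one half. Counting the jumps together with the excess lets one induction
  control both.
\<close>

lemma excess_before_exit:
  assumes L: "\<And>i. symmetric_law (L i)" and "finite I" "N s \<le> 1"
    and "1 + sum_expectation L trunc I N + (\<Sum>i\<in>I. emeasure (L i) far) \<le> M"
  shows "sum_expectation L trunc I (\<lambda>z. excess (s + z)) + (\<Sum>i\<in>I. emeasure (L i) far)
    \<le> 2 * M * sum_expectation L (\<lambda>x. x) I (\<lambda>z. indicator far (s + z))"
  using assms(2-)
proof (induction I arbitrary: s)
  case empty
  then show ?case by (simp add: excess_def ennreal_neg)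
next
  case (insert i I)
  interpret T: symmetric_laws L trunc using L by (rule symmetric_laws_trunc)
  interpret U: symmetric_laws L "\<lambda>x. x" using L by (rule symmetric_laws_id)
  define Q where "Q = (\<Sum>i\<in>I. emeasure (L i) far)"
  define EN where "EN = sum_expectation L trunc I N"
  define D where "D w = sum_expectation L trunc I (\<lambda>z. excess (w + z)) + Q" for w
  define P where "P w = sum_expectation L (\<lambda>x. x) I (\<lambda>z. indicator far (w + z))" for w
  have [measurable]: "D \<in> borel_measurable borel"
    unfolding D_def by (intro borel_measurable_add T.borel_measurable_sum_expectation) measurable
  have [measurable]: "P \<in> borel_measurable borel"
    unfolding P_def by (intro U.borel_measurable_sum_expectation) measurable
  have M: "1 + EN + Q \<le> M"
  proof -
    have "1 + EN + Q \<le> 1 + sum_expectation L trunc (insert i I) N + (emeasure (L i) far + Q)"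
      unfolding EN_def using insert sum_expectation_N_insert[OF L insert.hyps]
      by (intro add_mono) auto
    also have "\<dots> \<le> M" using insert by (simp add: Q_def)
    finally show ?thesis .
  qed
  then have IH: "D w \<le> 2 * M * P w" if "N w \<le> 1" for w
    unfolding D_def P_def Q_def EN_def using that by (intro insert.IH)
  have D_le: "D w \<le> ennreal c + EN + Q" if "N w \<le> 1 + c" "0 \<le> c" for w c
  proof -
    have "sum_expectation L trunc I (\<lambda>z. excess (w + z)) \<le> sum_expectation L trunc I (\<lambda>z. ennreal c + ennreal (N z))"
      using that by (intro sum_expectation_mono excess_add_le)
    also have "\<dots> = ennreal c + EN"
      unfolding EN_def by (subst T.sum_expectation_add) (auto simp: T.sum_expectation_const)
    finally show ?thesis unfolding D_def by (intro add_right_mono)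
  qed
  \<comment> \<open>If \<open>w\<close> is outside the ball, reflecting all the remaining summands leaves the sum outside at least half of the time.\<close>
  have Levy: "1 \<le> 2 * P w" if "w \<in> far" for w
  proof -
    have "1 = sum_expectation L (\<lambda>x. x) I (\<lambda>z. indicator far w)"
      using that by (simp add: U.sum_expectation_const)
    also have "\<dots> \<le> sum_expectation L (\<lambda>x. x) I (\<lambda>z. indicator far (w + z) + indicator far (w - z))"
      by (intro sum_expectation_mono far_either)
    also have "\<dots> = P w + sum_expectation L (\<lambda>x. x) I (\<lambda>z. indicator far (w + - z))"
      unfolding P_def by (subst U.sum_expectation_add) auto
    also have "\<dots> = P w + P w"
      unfolding P_def by (subst U.sum_expectation_reflect) (use insert in auto)
    finally show ?thesis by (simp add: mult_2)
  qed
  \<comment> \<open>If \<open>y\<close> is outside the ball, it is the past together with the future that is reflected. This brings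
    in \<open>s - y\<close>, and the symmetry of \<open>y\<close> turns \<open>s - y\<close> back into \<open>s + y\<close> after integration.\<close>
  have jump: "1 \<le> P (s + y) + P (s - y)" if "y \<in> far" for y
  proof -
    have "1 = sum_expectation L (\<lambda>x. x) I (\<lambda>z. indicator far y)"
      using that by (simp add: U.sum_expectation_const)
    also have "\<dots> \<le> sum_expectation L (\<lambda>x. x) I (\<lambda>z. indicator far (s + y + z) + indicator far (s - y + z))"
    proof (intro sum_expectation_mono)
      fix z
      have "indicator far (y - (s + z)) = (indicator far (s - y + z) :: ennreal)"
        using far_minus[of "y - (s + z)"] by (simp add: indicator_def algebra_simps)
      then show "indicator far y \<le> (indicator far (s + y + z) + indicator far (s - y + z) :: ennreal)"
        using far_either[of y "s + z"] by (simp add: algebra_simps)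
    qed
    also have "\<dots> = P (s + y) + P (s - y)"
      unfolding P_def by (subst U.sum_expectation_add) auto
    finally show ?thesis .
  qed
  \<comment> \<open>A jump \<open>y\<close> is truncated to \<open>0\<close>, so the walk stays at \<open>s\<close> and only the count increases by one.\<close>
  have step: "D (s + trunc y) + indicator far y
      \<le> M * (indicator far y * P (s + y) + indicator far y * P (s - y)) + 2 * M * (indicator (- far) y * P (s + y))" for y
  proof (cases "y \<in> far")
    case True
    have "D s + 1 \<le> EN + Q + 1"
      using D_le[of s 0] insert.prems by (intro add_right_mono) simp
    also have "\<dots> \<le> M" using M by (simp add: ac_simps)
    also have "\<dots> \<le> M * (P (s + y) + P (s - y))"
      using jump[OF True] mult_left_mono[of 1 _ M] by simp
    finally show ?thesis using True by (simp add: far_def trunc_def)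
  next
    case near: False
    have "D (s + y) \<le> 2 * M * P (s + y)"
    proof (cases "s + y \<in> far")
      case True
      have "D (s + y) \<le> M"
        using D_le[of "s + y" 1] insert.prems near triangle[of s y] M by (simp add: far_def)
      also have "\<dots> \<le> M * (2 * P (s + y))"
        using Levy[OF True] mult_left_mono[of 1 _ M] by simp
      finally show ?thesis by (simp add: ac_simps)
    next
      case False
      then show ?thesis by (intro IH) (simp add: far_def)
    qed
    then show ?thesis using near by (simp add: far_def trunc_def)
  qed
  have "sum_expectation L trunc (insert i I) (\<lambda>z. excess (s + z)) + (\<Sum>i\<in>insert i I. emeasure (L i) far)
     = (\<integral>\<^sup>+y. D (s + trunc y) + indicator far y \<partial>L i)"
  proof -
    interpret Li: prob_space "L i" by (rule T.prob_law)
    have "sum_expectation L trunc (insert i I) (\<lambda>z. excess (s + z)) =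
      (\<integral>\<^sup>+y. sum_expectation L trunc I (\<lambda>z. excess (s + trunc y + z)) \<partial>L i)"
      using insert by (subst T.sum_expectation_insert) (auto simp: add.assoc)
    also have "\<dots> + Q = (\<integral>\<^sup>+y. D (s + trunc y) \<partial>L i)"
    proof -
      have [measurable]: "(\<lambda>y. sum_expectation L trunc I (\<lambda>z. excess (s + trunc y + z))) \<in> borel_measurable (L i)"
        by (intro T.borel_measurable_sum_expectation) measurable
      show ?thesis unfolding D_def by (subst nn_integral_add) (auto simp: Li.emeasure_space_1)
    qed
    finally show ?thesis using insert
      by (subst nn_integral_add) (auto simp: Q_def[symmetric] ac_simps)
  qed
  also have "\<dots> \<le> (\<integral>\<^sup>+y. M * (indicator far y * P (s + y) + indicator far y * P (s - y))
       + 2 * M * (indicator (- far) y * P (s + y)) \<partial>L i)"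
    by (intro nn_integral_mono step)
  also have "\<dots> = M * ((\<integral>\<^sup>+y. indicator far y * P (s + y) \<partial>L i) + (\<integral>\<^sup>+y. indicator far y * P (s - y) \<partial>L i))
       + 2 * M * (\<integral>\<^sup>+y. indicator (- far) y * P (s + y) \<partial>L i)"
    by (simp add: nn_integral_add nn_integral_cmult)
  also have "(\<integral>\<^sup>+y. indicator far y * P (s - y) \<partial>L i) = (\<integral>\<^sup>+y. indicator far y * P (s + y) \<partial>L i)"
    using symmetric_law_reflect[OF L, of "\<lambda>y. indicator far y * P (s + y)" i]
    by (simp add: indicator_def)
  also have "M * ((\<integral>\<^sup>+y. indicator far y * P (s + y) \<partial>L i) + (\<integral>\<^sup>+y. indicator far y * P (s + y) \<partial>L i))
       + 2 * M * (\<integral>\<^sup>+y. indicator (- far) y * P (s + y) \<partial>L i)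
     = 2 * M * ((\<integral>\<^sup>+y. indicator far y * P (s + y) \<partial>L i) + (\<integral>\<^sup>+y. indicator (- far) y * P (s + y) \<partial>L i))"
    by (simp add: algebra_simps mult_2)
  also have "(\<integral>\<^sup>+y. indicator far y * P (s + y) \<partial>L i) + (\<integral>\<^sup>+y. indicator (- far) y * P (s + y) \<partial>L i)
     = (\<integral>\<^sup>+y. P (s + y) \<partial>L i)"
    by (subst nn_integral_add[symmetric]) (auto simp: indicator_def intro!: nn_integral_cong)
  also have "\<dots> = sum_expectation L (\<lambda>x. x) (insert i I) (\<lambda>z. indicator far (s + z))"
    using insert by (subst U.sum_expectation_insert) (auto simp: add.assoc P_def)
  finally show ?case .
qed

end

section \<open>Replacing dominated summands inside convex functions\<close>

definition convex_dominated :: "'a::{banach, second_countable_topology} measure \<Rightarrow> 'a measure \<Rightarrow> bool" where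
  "convex_dominated \<mu> \<nu> \<longleftrightarrow>
    (\<forall>K. closed K \<and> convex K \<and> uminus ` K = K \<longrightarrow> emeasure \<mu> (- K) \<le> emeasure \<nu> (- K))"

lemma convex_dominatedD:
  assumes "convex_dominated \<mu> \<nu>" "closed K" "convex K" "\<And>x. x \<in> K \<Longrightarrow> - x \<in> K"
  shows "emeasure \<mu> (- K) \<le> emeasure \<nu> (- K)"
proof -
  have "uminus ` K = K" using assms(4) by force
  then show ?thesis using assms unfolding convex_dominated_def by blast
qed

lemma ennreal_add_le: "ennreal (a + b) \<le> ennreal a + ennreal b"
proof -
  have "ennreal (a + b) \<le> ennreal (max 0 a + max 0 b)" by (intro ennreal_leI) auto
  also have "\<dots> = ennreal (max 0 a) + ennreal (max 0 b)" by (rule ennreal_plus) auto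
  also have "\<dots> = ennreal a + ennreal b" by (auto simp: max_def ennreal_neg)
  finally show ?thesis .
qed

context continuous_seminorm
begin

text \<open>
  These properties survive averaging over the remaining summands, as \<open>test_function_average\<close> shows, so that
  the summands can be replaced one by one. The Lipschitz bound limits the values on the
  unit ball to at most one more than the value at \<open>0\<close>, and it makes the sublevel sets closed even
  where infinite values occur.
\<close>

definition test_function :: "('a \<Rightarrow> ennreal) \<Rightarrow> bool" where
  "test_function F \<longleftrightarrow> (\<forall>z. F (- z) = F z) \<and>
    (\<forall>u v x y. 0 \<le> u \<longrightarrow> 0 \<le> v \<longrightarrow> u + v = 1 \<longrightarrow>
       F (u *\<^sub>R x + v *\<^sub>R y) \<le> ennreal u * F x + ennreal v * F y) \<and>
    (\<forall>x y. F (x + y) \<le> F x + ennreal (N y))"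

lemma test_functionD:
  assumes "test_function F"
  shows "F (- z) = F z"
    and "0 \<le> u \<Longrightarrow> 0 \<le> v \<Longrightarrow> u + v = 1 \<Longrightarrow> F (u *\<^sub>R x + v *\<^sub>R y) \<le> ennreal u * F x + ennreal v * F y"
    and "F (x + y) \<le> F x + ennreal (N y)"
  using assms unfolding test_function_def by blast+

lemma test_function_sublevel:
  assumes F: "test_function F"
  shows "closed {x. F x \<le> t}" and "convex {x. F x \<le> t}"
proof -
  show "closed {x. F x \<le> t}"
  proof (unfold closed_sequential_limits, intro allI impI)
    fix X x assume X: "(\<forall>k. X k \<in> {x. F x \<le> t}) \<and> X \<longlonglongrightarrow> x"
    have "isCont N 0" using continuous_on_N by (simp add: continuous_on_eq_continuous_at)
    moreover have "(\<lambda>k. x - X k) \<longlonglongrightarrow> 0" using X tendsto_diff[of "\<lambda>_. x" x _ X x] by simp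
    ultimately have "(\<lambda>k. N (x - X k)) \<longlonglongrightarrow> N 0" by (rule isCont_tendsto_compose)
    then have "(\<lambda>k. t + ennreal (N (x - X k))) \<longlonglongrightarrow> t + ennreal (N 0)"
      by (intro tendsto_intros tendsto_ennrealI)
    moreover have "F x \<le> t + ennreal (N (x - X k))" for k
    proof -
      have "F x \<le> F (X k) + ennreal (N (x - X k))"
        using test_functionD(3)[OF F, of "X k" "x - X k"] by simp
      also have "\<dots> \<le> t + ennreal (N (x - X k))" using X by (intro add_right_mono) auto
      finally show ?thesis .
    qed
    ultimately show "x \<in> {x. F x \<le> t}"
      using LIMSEQ_le_const by fastforce
  qed
  show "convex {x. F x \<le> t}"
  proof (rule convexI)
    fix x y :: 'a and u v :: real
    assume uv: "0 \<le> u" "0 \<le> v" "u + v = 1" and xy: "x \<in> {x. F x \<le> t}" "y \<in> {x. F x \<le> t}"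
    have "F (u *\<^sub>R x + v *\<^sub>R y) \<le> ennreal u * F x + ennreal v * F y"
      using test_functionD(2)[OF F] uv by blast
    also have "\<dots> \<le> ennreal u * t + ennreal v * t"
      using xy by (intro add_mono mult_left_mono) auto
    also have "\<dots> = ennreal (u + v) * t"
      using uv by (metis ennreal_plus distrib_right)
    finally show "u *\<^sub>R x + v *\<^sub>R y \<in> {x. F x \<le> t}" using uv by simp
  qed
qed

lemma test_function_borel:
  assumes "test_function F" shows "F \<in> borel_measurable borel"
  using test_function_sublevel(1)[OF assms] by (intro borel_measurableI_le) auto

lemma test_function_excess: "test_function excess"
  unfolding test_function_def
proof (intro conjI allI impI)
  fix x y
  show "excess (x + y) \<le> excess x + ennreal (N y)"
  proof -
    have "excess (x + y) \<le> ennreal ((N x - 1) + N y)"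
      unfolding excess_def using triangle[of x y] by (intro ennreal_leI) simp
    then show ?thesis unfolding excess_def using ennreal_add_le order_trans by blast
  qed
next
  fix u v :: real and x y assume uv: "0 \<le> u" "0 \<le> v" "u + v = 1"
  have "N (u *\<^sub>R x + v *\<^sub>R y) - (u + v) \<le> u * (N x - 1) + v * (N y - 1)"
    using triangle[of "u *\<^sub>R x" "v *\<^sub>R y"] uv by (simp add: homogeneous algebra_simps)
  then have "excess (u *\<^sub>R x + v *\<^sub>R y) \<le> ennreal (u * (N x - 1) + v * (N y - 1))"
    unfolding excess_def using uv by (intro ennreal_leI) simp
  also have "\<dots> \<le> ennreal (u * (N x - 1)) + ennreal (v * (N y - 1))" by (rule ennreal_add_le)
  finally show "excess (u *\<^sub>R x + v *\<^sub>R y) \<le> ennreal u * excess x + ennreal v * excess y"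
    using uv by (simp add: excess_def ennreal_mult')
qed (simp add: excess_def)

lemma test_function_average:
  assumes F: "test_function F" and R: "prob_space R" and k [measurable]: "k \<in> borel_measurable R"
    and reflect: "\<And>G. G \<in> borel_measurable borel \<Longrightarrow>
      (\<integral>\<^sup>+w. G (- k w) \<partial>R) = (\<integral>\<^sup>+w. (G (k w) :: ennreal) \<partial>R)"
  shows "test_function (\<lambda>z. \<integral>\<^sup>+w. F (z + k w) \<partial>R)"
  unfolding test_function_def
proof (intro conjI allI impI)
  interpret R: prob_space R by (rule R)
  note [measurable] = test_function_borel[OF F]
  show "(\<integral>\<^sup>+w. F (- z + k w) \<partial>R) = (\<integral>\<^sup>+w. F (z + k w) \<partial>R)" for z
  proof -
    have "F (- z + k w) = F (z + - k w)" for w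
      using test_functionD(1)[OF F, of "z + - k w"] by simp
    then show ?thesis using reflect[of "\<lambda>x. F (z + x)"] by simp
  qed
  show "(\<integral>\<^sup>+w. F (x + y + k w) \<partial>R) \<le> (\<integral>\<^sup>+w. F (x + k w) \<partial>R) + ennreal (N y)" for x y
  proof -
    have "(\<integral>\<^sup>+w. F (x + y + k w) \<partial>R) \<le> (\<integral>\<^sup>+w. F (x + k w) + ennreal (N y) \<partial>R)"
    proof (intro nn_integral_mono)
      show "F (x + y + k w) \<le> F (x + k w) + ennreal (N y)" for w
        using test_functionD(3)[OF F, of "x + k w" y] by (simp add: ac_simps)
    qed
    also have "\<dots> = (\<integral>\<^sup>+w. F (x + k w) \<partial>R) + ennreal (N y)"
      by (subst nn_integral_add) (auto simp: R.emeasure_space_1)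
    finally show ?thesis .
  qed
  fix u v :: real and x y assume uv: "0 \<le> u" "0 \<le> v" "u + v = 1"
  have "(\<integral>\<^sup>+w. F (u *\<^sub>R x + v *\<^sub>R y + k w) \<partial>R) \<le> (\<integral>\<^sup>+w. ennreal u * F (x + k w) + ennreal v * F (y + k w) \<partial>R)"
  proof (intro nn_integral_mono)
    fix w
    have "u *\<^sub>R x + v *\<^sub>R y + k w = u *\<^sub>R (x + k w) + v *\<^sub>R (y + k w)"
      using uv(3) by (simp add: scaleR_add_right algebra_simps flip: scaleR_add_left)
    then show "F (u *\<^sub>R x + v *\<^sub>R y + k w) \<le> ennreal u * F (x + k w) + ennreal v * F (y + k w)"
      using test_functionD(2)[OF F uv] by simp
  qed
  also have "\<dots> = ennreal u * (\<integral>\<^sup>+w. F (x + k w) \<partial>R) + ennreal v * (\<integral>\<^sup>+w. F (y + k w) \<partial>R)"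
    by (simp add: nn_integral_add nn_integral_cmult)
  finally show "(\<integral>\<^sup>+w. F (u *\<^sub>R x + v *\<^sub>R y + k w) \<partial>R)
    \<le> ennreal u * (\<integral>\<^sup>+w. F (x + k w) \<partial>R) + ennreal v * (\<integral>\<^sup>+w. F (y + k w) \<partial>R)" .
qed

lemma unit_ball: "closed {x. N x \<le> 1}" "convex {x. N x \<le> 1}"
proof -
  show "closed {x. N x \<le> 1}"
    using continuous_on_N by (intro closed_Collect_le continuous_intros)
  show "convex {x. N x \<le> 1}"
  proof (rule convexI)
    fix x y :: 'a and u v :: real
    assume uv: "0 \<le> u" "0 \<le> v" "u + v = 1" and xy: "x \<in> {x. N x \<le> 1}" "y \<in> {x. N x \<le> 1}"
    have "N (u *\<^sub>R x + v *\<^sub>R y) \<le> u * N x + v * N y"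
      using triangle[of "u *\<^sub>R x" "v *\<^sub>R y"] uv by (simp add: homogeneous)
    also have "\<dots> \<le> u * 1 + v * 1" using uv xy by (intro add_mono mult_left_mono) auto
    finally show "u *\<^sub>R x + v *\<^sub>R y \<in> {x. N x \<le> 1}" using uv by simp
  qed
qed

lemma emeasure_far_mono: "convex_dominated \<mu> \<nu> \<Longrightarrow> emeasure \<mu> far \<le> emeasure \<nu> far"
  using convex_dominatedD[of \<mu> \<nu> "{x. N x \<le> 1}"] unit_ball
  by (simp add: far_def Collect_neg_eq[symmetric] not_le)

text \<open>
  The function \<open>\<phi>\<close> of the truncated variable need not be quasi-convex in the original one, since it falls back to
  \<open>\<phi> 0\<close> outside the ball. Raising it there to the constant \<open>\<phi> 0 + 1\<close>, which bounds \<open>\<phi>\<close> on the ball, makes it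
  quasi-convex. The change increases the expectation on the side of \<open>\<nu>\<close> by exactly the
  probability of leaving the ball.
\<close>

lemma replace_one_summand:
  assumes \<phi>: "test_function \<phi>" and \<mu>: "symmetric_law \<mu>" and \<nu>: "symmetric_law \<nu>"
    and dom: "convex_dominated \<mu> \<nu>"
  shows "(\<integral>\<^sup>+y. \<phi> (trunc y) \<partial>\<mu>) \<le> (\<integral>\<^sup>+y. \<phi> (trunc y) \<partial>\<nu>) + emeasure \<nu> far"
proof -
  have [measurable_cong]: "sets \<mu> = sets borel" "sets \<nu> = sets borel"
    using \<mu> \<nu> by (auto simp: symmetric_law_def)
  have space: "space \<mu> = UNIV" "space \<nu> = UNIV"
    using \<mu> \<nu> by (auto simp: symmetric_law_def dest: sets_eq_imp_space_eq)
  note [measurable] = test_function_borel[OF \<phi>]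
  define \<psi> where "\<psi> y = (if N y \<le> 1 then \<phi> y else \<phi> 0 + 1)" for y
  have [measurable]: "\<psi> \<in> borel_measurable borel" unfolding \<psi>_def by measurable
  have \<phi>_le: "\<phi> y \<le> \<phi> 0 + ennreal (N y)" for y
    using test_functionD(3)[OF \<phi>, of 0 y] by simp
  have \<psi>_le: "\<psi> y \<le> \<phi> 0 + 1" for y
    using \<phi>_le[of y] by (auto simp: \<psi>_def intro: order_trans[OF _ add_left_mono])
  have "(\<integral>\<^sup>+y. \<phi> (trunc y) \<partial>\<mu>) \<le> (\<integral>\<^sup>+y. \<psi> y \<partial>\<mu>)"
    by (intro nn_integral_mono) (auto simp: \<psi>_def trunc_def)
  also have "\<dots> \<le> (\<integral>\<^sup>+y. \<psi> y \<partial>\<nu>)"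
  proof (rule nn_integral_mono_tails)
    fix t :: real
    show "emeasure \<mu> {x \<in> space \<mu>. ennreal t < \<psi> x} \<le> emeasure \<nu> {x \<in> space \<nu>. ennreal t < \<psi> x}"
    proof (cases "\<phi> 0 + 1 \<le> ennreal t")
      case True
      then have "{x. ennreal t < \<psi> x} = {}" using \<psi>_le order_trans not_le by blast
      then show ?thesis by (simp add: space)
    next
      case False
      define K where "K = {x. N x \<le> 1} \<inter> {x. \<phi> x \<le> ennreal t}"
      have K: "{x. ennreal t < \<psi> x} = - K"
        using False by (auto simp: K_def \<psi>_def not_le)
      have "emeasure \<mu> (- K) \<le> emeasure \<nu> (- K)"
      proof (rule convex_dominatedD[OF dom])
        show "closed K" "convex K" unfolding K_def
          by (intro closed_Int convex_Int unit_ball test_function_sublevel[OF \<phi>])+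
        show "- x \<in> K" if "x \<in> K" for x
          using that by (simp add: K_def test_functionD(1)[OF \<phi>])
      qed
      then show ?thesis by (simp add: space K)
    qed
  qed (use \<mu> \<nu> in \<open>auto simp: symmetric_law_def prob_space_imp_sigma_finite\<close>)
  also have "\<dots> \<le> (\<integral>\<^sup>+y. \<phi> (trunc y) + indicator far y \<partial>\<nu>)"
    by (intro nn_integral_mono) (auto simp: \<psi>_def trunc_def far_def)
  also have "\<dots> = (\<integral>\<^sup>+y. \<phi> (trunc y) \<partial>\<nu>) + emeasure \<nu> far"
    by (subst nn_integral_add) auto
  finally show ?thesis .
qed

text \<open>
  With the other summands integrated out, the expectation is a test function of the summand to be
  replaced; the cost of the replacement does not depend on that function, so the costs add up.
\<close>

lemma replace_all_summands:
  assumes \<mu>: "\<And>i. symmetric_law (\<mu> i)" and \<nu>: "\<And>i. symmetric_law (\<nu> i)"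
    and dom: "\<And>i. convex_dominated (\<mu> i) (\<nu> i)"
    and "finite I" "test_function F"
  shows "sum_expectation \<mu> trunc I F \<le> sum_expectation \<nu> trunc I F + (\<Sum>i\<in>I. emeasure (\<nu> i) far)"
  using assms(4-)
proof (induction I arbitrary: F)
  case (insert i I)
  interpret X: symmetric_laws \<mu> trunc using \<mu> by (rule symmetric_laws_trunc)
  interpret Y: symmetric_laws \<nu> trunc using \<nu> by (rule symmetric_laws_trunc)
  note [measurable] = test_function_borel[OF insert.prems]
  define \<phi> where "\<phi> w = sum_expectation \<nu> trunc I (\<lambda>z. F (w + z))" for w
  define Q where "Q = (\<Sum>i\<in>I. emeasure (\<nu> i) far)"
  \<comment> \<open>The induction hypothesis is used for \<open>F\<close> averaged over the \<open>i\<close>-th summand with its old law; the law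
    of that summand is changed afterwards, with the new laws of the others already in place.\<close>
  have F1: "test_function (\<lambda>z. \<integral>\<^sup>+y. F (z + trunc y) \<partial>\<mu> i)"
  proof (rule test_function_average[OF insert.prems X.prob_law])
    show "(\<integral>\<^sup>+w. G (- trunc w) \<partial>\<mu> i) = (\<integral>\<^sup>+w. G (trunc w) \<partial>\<mu> i)"
      if [measurable]: "G \<in> borel_measurable borel" for G
      using symmetric_law_reflect[OF \<mu>, of "\<lambda>y. G (trunc y)" i] by (simp add: trunc_minus)
  qed measurable
  have \<phi>: "test_function \<phi>"
    unfolding \<phi>_def sum_expectation_def
  proof (rule test_function_average[OF insert.prems Y.prob_space_product])
    show "(\<integral>\<^sup>+w. G (- (\<Sum>i\<in>I. trunc (w i))) \<partial>Pi\<^sub>M I \<nu>) = (\<integral>\<^sup>+w. G (\<Sum>i\<in>I. trunc (w i)) \<partial>Pi\<^sub>M I \<nu>)"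
      if "G \<in> borel_measurable borel" for G
      using Y.sum_expectation_reflect[OF insert.hyps(1) that] unfolding sum_expectation_def .
  qed measurable
  have "sum_expectation \<mu> trunc (insert i I) F = sum_expectation \<mu> trunc I (\<lambda>z. \<integral>\<^sup>+y. F (trunc y + z) \<partial>\<mu> i)"
    by (subst X.sum_expectation_insert[OF insert.hyps], measurable, rule X.sum_expectation_swap[OF X.prob_law], measurable)
  also have "\<dots> \<le> sum_expectation \<nu> trunc I (\<lambda>z. \<integral>\<^sup>+y. F (trunc y + z) \<partial>\<mu> i) + Q"
    unfolding Q_def using insert.IH[OF F1] by (simp add: add.commute)
  also have "sum_expectation \<nu> trunc I (\<lambda>z. \<integral>\<^sup>+y. F (trunc y + z) \<partial>\<mu> i) = (\<integral>\<^sup>+y. \<phi> (trunc y) \<partial>\<mu> i)"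
    unfolding \<phi>_def by (rule Y.sum_expectation_swap[symmetric, OF X.prob_law]) measurable
  also have "\<dots> \<le> (\<integral>\<^sup>+y. \<phi> (trunc y) \<partial>\<nu> i) + emeasure (\<nu> i) far"
    by (rule replace_one_summand[OF \<phi> \<mu> \<nu> dom])
  also have "(\<integral>\<^sup>+y. \<phi> (trunc y) \<partial>\<nu> i) = sum_expectation \<nu> trunc (insert i I) F"
    unfolding \<phi>_def by (rule Y.sum_expectation_insert[OF insert.hyps, symmetric]) measurable
  finally show ?case using insert.hyps by (simp add: Q_def ac_simps)
qed simp

text \<open>
  A jump of some summand out of the ball is paid for by the union bound, and the remaining event by
  Markov's inequality for the excess of the truncated sum. Truncation makes the expected excess \<open>D\<close> finite,
  which is what allows the self-bounding inequality \<open>D \<le> 2 (2 + D) p\<close> to be solved for \<open>D\<close>.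
\<close>

lemma unit_domination:
  assumes \<mu>: "\<And>i. symmetric_law (\<mu> i)" and \<nu>: "\<And>i. symmetric_law (\<nu> i)"
    and dom: "\<And>i. convex_dominated (\<mu> i) (\<nu> i)"
    and I: "finite I" and \<alpha>: "0 < \<alpha>" "\<alpha> \<le> 1"
  shows "sum_expectation \<mu> (\<lambda>x. x) I (indicator {x. 1 + \<alpha> < N x})
    \<le> ennreal (16 / \<alpha>) * sum_expectation \<nu> (\<lambda>x. x) I (indicator {x. 1 < N x})"
proof -
  interpret X: symmetric_laws \<mu> "\<lambda>x. x" using \<mu> by (rule symmetric_laws_id)
  interpret Y: symmetric_laws \<nu> "\<lambda>x. x" using \<nu> by (rule symmetric_laws_id)
  interpret TX: symmetric_laws \<mu> trunc using \<mu> by (rule symmetric_laws_trunc)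
  interpret TY: symmetric_laws \<nu> trunc using \<nu> by (rule symmetric_laws_trunc)
  define Q where "Q = (\<Sum>i\<in>I. emeasure (\<nu> i) far)"
  define D where "D = sum_expectation \<nu> trunc I excess + Q"
  define P where "P = sum_expectation \<nu> (\<lambda>x. x) I (indicator far)"
  define PX where "PX = sum_expectation \<mu> (\<lambda>x. x) I (indicator {x. 1 + \<alpha> < N x})"
  have "PX \<le> 1"
    unfolding PX_def using sum_expectation_mono[of "indicator {x. 1 + \<alpha> < N x}" "\<lambda>_. 1" \<mu> "\<lambda>x. x" I]
    by (simp add: X.sum_expectation_const indicator_def)
  have "P \<le> 1"
    unfolding P_def using sum_expectation_mono[of "indicator far" "\<lambda>_. 1" \<nu> "\<lambda>x. x" I]
    by (simp add: Y.sum_expectation_const indicator_def)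
  then obtain p where p: "P = ennreal p" "0 \<le> p" by (cases P) (auto simp: top_unique)
  have EN_le: "sum_expectation \<nu> trunc I N \<le> 1 + sum_expectation \<nu> trunc I excess"
  proof -
    have "sum_expectation \<nu> trunc I N \<le> sum_expectation \<nu> trunc I (\<lambda>z. 1 + excess z)"
      using ennreal_add_le[of 1 "N _ - 1"] by (intro sum_expectation_mono) (simp add: excess_def)
    also have "\<dots> = 1 + sum_expectation \<nu> trunc I excess"
      by (subst TY.sum_expectation_add) (auto simp: TY.sum_expectation_const)
    finally show ?thesis .
  qed
  have "D \<noteq> top"
  proof -
    have "sum_expectation \<nu> trunc I excess \<le> sum_expectation \<nu> trunc I (\<lambda>z. of_nat (card I))"
      unfolding sum_expectation_def
    proof (intro nn_integral_mono)
      fix x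
      have "N (\<Sum>i\<in>I. trunc (x i)) \<le> (\<Sum>i\<in>I. 1)"
        by (rule order_trans[OF N_sum_le sum_mono[OF N_trunc_le]])
      then show "excess (\<Sum>i\<in>I. trunc (x i)) \<le> of_nat (card I)"
        unfolding excess_def ennreal_of_nat_eq_real_of_nat by (intro ennreal_leI) simp
    qed
    moreover have "emeasure (\<nu> i) far \<noteq> top" for i
      using Y.prob_law[of i] by (simp add: finite_measure.emeasure_finite prob_space.finite_measure)
    ultimately show ?thesis unfolding D_def Q_def using I
      by (auto simp: TY.sum_expectation_const top_unique)
  qed
  then obtain d where d: "D = ennreal d" "0 \<le> d" by (cases D) auto
  have "D \<le> 2 * (1 + sum_expectation \<nu> trunc I N + Q) * P"
    using excess_before_exit[where L = \<nu> and s = 0, OF \<nu> I _ order_refl]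
    unfolding D_def P_def Q_def by simp
  also have "\<dots> \<le> 2 * (2 + D) * P"
    using EN_le unfolding D_def
    by (intro mult_left_mono mult_right_mono) (auto simp: ac_simps intro: order_trans[OF add_left_mono])
  also have "\<dots> = ennreal (2 * (2 + d) * p)"
    using p d by (simp add: ennreal_mult' ennreal_plus)
  finally have dp: "d \<le> 2 * (2 + d) * p" using p d by simp
  have PX_le: "PX \<le> ennreal (2 * d / \<alpha>)"
  proof -
    have pointwise: "indicator {x. 1 + \<alpha> < N x} (\<Sum>i\<in>I. x i)
      \<le> (\<Sum>i\<in>I. indicator far (x i)) + ennreal (1 / \<alpha>) * excess (\<Sum>i\<in>I. trunc (x i))" for x
    proof (cases "\<exists>i\<in>I. x i \<in> far")
      case True
      then obtain i where "i \<in> I" "x i \<in> far" by blast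
      then have "(1::ennreal) \<le> (\<Sum>i\<in>I. indicator far (x i))"
        using member_le_sum[of i I "\<lambda>i. indicator far (x i) :: ennreal"] I by simp
      then show ?thesis by (auto simp: indicator_def add_increasing2)
    next
      case False
      then have "(\<Sum>i\<in>I. trunc (x i)) = (\<Sum>i\<in>I. x i)"
        by (intro sum.cong) (auto simp: trunc_def far_def)
      moreover have "1 \<le> ennreal (1 / \<alpha>) * excess z" if "1 + \<alpha> < N z" for z
      proof -
        have "1 \<le> (N z - 1) / \<alpha>" using that \<alpha> by (simp add: field_simps)
        then have "1 \<le> ennreal ((N z - 1) / \<alpha>)" by simp
        also have "\<dots> = ennreal (1 / \<alpha>) * excess z"
          unfolding excess_def using \<alpha> by (simp flip: ennreal_mult')
        finally show ?thesis .
      qed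
      ultimately show ?thesis by (auto simp: indicator_def add_increasing)
    qed
    have "PX \<le> (\<integral>\<^sup>+x. (\<Sum>i\<in>I. indicator far (x i)) + ennreal (1 / \<alpha>) * excess (\<Sum>i\<in>I. trunc (x i)) \<partial>Pi\<^sub>M I \<mu>)"
      unfolding PX_def sum_expectation_def by (intro nn_integral_mono pointwise)
    also have "\<dots> = (\<Sum>i\<in>I. \<integral>\<^sup>+x. indicator far (x i) \<partial>Pi\<^sub>M I \<mu>) + ennreal (1 / \<alpha>) * sum_expectation \<mu> trunc I excess"
    proof -
      have far_coord: "(\<lambda>x. indicator far (x i) :: ennreal) \<in> borel_measurable (Pi\<^sub>M I \<mu>)" if "i \<in> I" for i
        using that by measurable
      have excess_sum: "(\<lambda>x. excess (\<Sum>i\<in>I. trunc (x i))) \<in> borel_measurable (Pi\<^sub>M I \<mu>)"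
        by (rule measurable_compose[OF TX.measurable_partial_sum excess_borel])
      have "(\<integral>\<^sup>+x. (\<Sum>i\<in>I. indicator far (x i)) + ennreal (1 / \<alpha>) * excess (\<Sum>i\<in>I. trunc (x i)) \<partial>Pi\<^sub>M I \<mu>)
        = (\<integral>\<^sup>+x. (\<Sum>i\<in>I. indicator far (x i)) \<partial>Pi\<^sub>M I \<mu>)
          + (\<integral>\<^sup>+x. ennreal (1 / \<alpha>) * excess (\<Sum>i\<in>I. trunc (x i)) \<partial>Pi\<^sub>M I \<mu>)"
        by (rule nn_integral_add[OF borel_measurable_sum[OF far_coord]
              borel_measurable_times_ennreal[OF borel_measurable_const excess_sum]])
      also have "(\<integral>\<^sup>+x. (\<Sum>i\<in>I. indicator far (x i)) \<partial>Pi\<^sub>M I \<mu>) = (\<Sum>i\<in>I. \<integral>\<^sup>+x. indicator far (x i) \<partial>Pi\<^sub>M I \<mu>)"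
        by (rule nn_integral_sum[OF far_coord])
      also have "(\<integral>\<^sup>+x. ennreal (1 / \<alpha>) * excess (\<Sum>i\<in>I. trunc (x i)) \<partial>Pi\<^sub>M I \<mu>)
        = ennreal (1 / \<alpha>) * sum_expectation \<mu> trunc I excess"
        unfolding sum_expectation_def by (rule nn_integral_cmult[OF excess_sum])
      finally show ?thesis .
    qed
    also have "(\<Sum>i\<in>I. \<integral>\<^sup>+x. indicator far (x i) \<partial>Pi\<^sub>M I \<mu>) \<le> Q"
      unfolding Q_def
    proof (intro sum_mono)
      fix i assume i: "i \<in> I"
      have "(\<integral>\<^sup>+x. indicator far (x i) \<partial>Pi\<^sub>M I \<mu>) = (\<integral>\<^sup>+y. indicator far y \<partial>distr (Pi\<^sub>M I \<mu>) (\<mu> i) (\<lambda>x. x i))"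
        using i by (intro nn_integral_distr[symmetric]) measurable
      also have "\<dots> = emeasure (\<mu> i) far"
        using i X.prob_law by (simp add: distr_PiM_component)
      finally show "(\<integral>\<^sup>+x. indicator far (x i) \<partial>Pi\<^sub>M I \<mu>) \<le> emeasure (\<nu> i) far"
        using emeasure_far_mono[OF dom] by simp
    qed
    also have "Q + ennreal (1 / \<alpha>) * sum_expectation \<mu> trunc I excess \<le> D + ennreal (1 / \<alpha>) * D"
      using replace_all_summands[OF \<mu> \<nu> dom I test_function_excess]
      unfolding D_def Q_def by (intro add_mono mult_left_mono) auto
    also have "\<dots> = ennreal (d + d / \<alpha>)"
      using d \<alpha> by (simp add: ennreal_plus flip: ennreal_mult')
    also have "\<dots> \<le> ennreal (2 * d / \<alpha>)"
      using d \<alpha> by (intro ennreal_leI) (simp add: field_simps mult_left_le_one_le)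
    finally show ?thesis by (simp add: add_right_mono)
  qed
  have "PX \<le> ennreal (16 / \<alpha> * p)"
  \<comment> \<open>For larger \<open>p\<close> the right-hand side is at least \<open>1\<close>.\<close>
  proof (cases "p \<le> 1 / 4")
    case True
    have "d * (2 * p) \<le> d * (1 / 2)" using True d by (intro mult_left_mono) auto
    then have "d \<le> 8 * p" using dp by (simp add: algebra_simps)
    then have "2 * d / \<alpha> \<le> 16 / \<alpha> * p" using \<alpha> by (simp add: field_simps)
    then show ?thesis using PX_le by (meson ennreal_leI order_trans)
  next
    case False
    then have "1 \<le> 16 / \<alpha> * p" using \<alpha> by (simp add: field_simps)
    then show ?thesis using \<open>PX \<le> 1\<close> by (meson ennreal_ge_1 order_trans)
  qed
  also have "\<dots> = ennreal (16 / \<alpha>) * P"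
    using p \<alpha> ennreal_mult'[of "16 / \<alpha>" p] by simp
  finally show ?thesis unfolding PX_def P_def far_def .
qed

end

section \<open>Removing the multiplicative constant by random splitting\<close>

lemma zero_mem_symmetric_convex:
  fixes K :: "'a::real_vector set"
  assumes "convex K" "x \<in> K" "- x \<in> K"
  shows "0 \<in> K"
  using convexD[OF assms(1) assms(2,3), of "1/2" "1/2"] by simp

text \<open>
  Each summand is paired with an independent uniform label in \<open>{..<m}\<close>, and \<open>part j\<close> keeps the summands with
  label \<open>j\<close>. For fixed \<open>j\<close> the kept summands are independent, symmetric and dominated with constant \<open>1\<close>. The \<open>m\<close> partial
  sums are dependent, but a union bound suffices for them.
\<close>

lemma (in continuous_seminorm) domination_by_thinning:
  fixes m :: nat
  assumes \<mu>: "\<And>i. symmetric_law (\<mu> i)" and \<nu>: "\<And>i. symmetric_law (\<nu> i)"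
    and dom: "\<And>i K. closed K \<Longrightarrow> convex K \<Longrightarrow> uminus ` K = K \<Longrightarrow>
      emeasure (\<mu> i) (- K) \<le> of_nat m * emeasure (\<nu> i) (- K)"
    and m: "1 \<le> m" and I: "finite I" and \<alpha>: "0 < \<alpha>" "\<alpha> \<le> 1"
  shows "sum_expectation \<mu> (\<lambda>x. x) I (indicator {x. real m * (1 + \<alpha>) < N x})
    \<le> of_nat m * (ennreal (16 / \<alpha>) * sum_expectation \<nu> (\<lambda>x. x) I (indicator {x. 1 < N x}))"
proof -
  define U where "U = uniform_count_measure {..<m}"
  define R where "R i = \<mu> i \<Otimes>\<^sub>M U" for i
  define part where "part j r = (if snd r = j then fst r else 0)" for j :: nat and r :: "'a \<times> nat"
  define T where "T j i = distr (R i) borel (part j)" for j i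
  have sets_laws [measurable_cong]: "sets (\<mu> i) = sets borel" "sets (\<nu> i) = sets borel" for i
    using \<mu> \<nu> by (auto simp: symmetric_law_def)
  have [measurable_cong]: "sets U = sets (count_space {..<m})"
    by (simp add: U_def sets_uniform_count_measure)
  have space_U: "space U = {..<m}" by (simp add: U_def space_uniform_count_measure)
  have space_\<mu>: "space (\<mu> i) = UNIV" for i
    using \<mu>[of i] by (auto simp: symmetric_law_def dest: sets_eq_imp_space_eq)
  interpret U: prob_space U
    unfolding U_def using m by (intro prob_space_uniform_count_measure) (auto simp: lessThan_empty_iff)
  have prob_R: "prob_space (R i)" for i
  proof -
    interpret Mi: prob_space "\<mu> i" using \<mu> by (simp add: symmetric_law_def)
    interpret MiU: pair_prob_space "\<mu> i" U ..
    show ?thesis unfolding R_def by (rule MiU.prob_space_axioms)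
  qed
  have part_R [measurable]: "part j \<in> borel_measurable (R i)" for j i
    unfolding part_def R_def by measurable
  have fst_R [measurable]: "fst \<in> borel_measurable (R i)" for i
    unfolding R_def by measurable
  have parts: "summand_laws R (part j)" for j
    using prob_R part_R by (rule summand_laws.intro)
  have fsts: "summand_laws R fst"
    using prob_R fst_R by (rule summand_laws.intro)

  have T_symmetric: "symmetric_law (T j i)" for j i
  proof -
    let ?flip = "\<lambda>(x, v). (- x :: 'a, v :: nat)"
    have flip [measurable]: "?flip \<in> measurable (R i) (R i)" unfolding R_def by measurable
    have "R i = distr (\<mu> i) borel uminus \<Otimes>\<^sub>M distr U U (\<lambda>v. v)"
      using \<mu>[of i] by (simp add: R_def symmetric_law_def distr_id2)
    also have "\<dots> = distr (\<mu> i \<Otimes>\<^sub>M U) (borel \<Otimes>\<^sub>M U) ?flip"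
      by (intro pair_measure_distr) (auto simp: distr_id2 U.sigma_finite_measure_axioms)
    also have "\<dots> = distr (R i) (R i) ?flip"
      unfolding R_def using \<mu>[of i]
      by (intro distr_cong sets_pair_measure_cong) (auto simp: symmetric_law_def)
    finally have R_flip: "distr (R i) (R i) ?flip = R i" by simp
    have "distr (T j i) borel uminus = distr (R i) borel (\<lambda>r. - part j r)"
      unfolding T_def by (subst distr_distr) (auto simp: comp_def)
    also have "(\<lambda>r. - part j r) = part j \<circ> ?flip" by (auto simp: part_def fun_eq_iff)
    also have "distr (R i) borel (part j \<circ> ?flip) = distr (distr (R i) (R i) ?flip) borel (part j)"
      by (subst distr_distr) auto
    also have "\<dots> = T j i" unfolding R_flip T_def ..
    finally show ?thesis
      unfolding symmetric_law_def T_def using prob_space.prob_space_distr[OF prob_R part_R] by simp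
  qed

  have T_dominated: "convex_dominated (T j i) (\<nu> i)" if j: "j < m" for j i
    unfolding convex_dominated_def
  proof (intro allI impI)
    fix K :: "'a set" assume K: "closed K \<and> convex K \<and> uminus ` K = K"
    show "emeasure (T j i) (- K) \<le> emeasure (\<nu> i) (- K)"
    proof (cases "K = {}")
      case True
      have "emeasure L UNIV = 1" if "symmetric_law L" for L :: "'a measure"
        using that prob_space.emeasure_space_1[of L] by (auto simp: symmetric_law_def dest: sets_eq_imp_space_eq)
      then show ?thesis using True T_symmetric \<nu> by simp
    next
      case False
      then have "0 \<in> K" using K zero_mem_symmetric_convex by blast
      have [measurable]: "K \<in> sets borel" using K by (simp add: borel_closed)
      \<comment> \<open>As \<open>0\<close> lies in \<open>K\<close>, only the label \<open>j\<close> can lead out of \<open>K\<close>.\<close>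
      have "part j -` (- K) \<inter> space (R i) = (- K) \<times> {j}"
        using \<open>0 \<in> K\<close> j by (auto simp: part_def R_def space_pair_measure space_\<mu> space_U split: if_splits)
      then have "emeasure (T j i) (- K) = emeasure (\<mu> i \<Otimes>\<^sub>M U) ((- K) \<times> {j})"
        unfolding T_def using part_R[of j i, unfolded R_def] by (subst emeasure_distr) (auto simp: R_def)
      also have "\<dots> = emeasure (\<mu> i) (- K) * emeasure U {j}"
        using j by (intro U.emeasure_pair_measure_Times) auto
      also have "emeasure U {j} = ennreal (1 / real m)"
        using j by (simp add: U_def emeasure_uniform_count_measure)
      also have "emeasure (\<mu> i) (- K) * ennreal (1 / real m) \<le> of_nat m * emeasure (\<nu> i) (- K) * ennreal (1 / real m)"
        using dom K by (intro mult_right_mono) auto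
      also have "\<dots> = emeasure (\<nu> i) (- K) * (of_nat m * ennreal (1 / real m))"
        by (simp add: ac_simps)
      also have "of_nat m * ennreal (1 / real m) = 1"
        using m by (simp add: ennreal_of_nat_eq_real_of_nat flip: ennreal_mult')
      finally show ?thesis by simp
    qed
  qed

  have \<mu>_R: "\<mu> = (\<lambda>i. distr (R i) borel fst)"
  proof
    fix i
    have "\<mu> i = distr (\<mu> i) borel (\<lambda>x. x)" using sets_laws(1)[of i] by (intro distr_id2[symmetric]) simp
    also have "\<dots> = distr (distr (R i) (\<mu> i) fst) borel (\<lambda>x. x)"
      by (simp add: R_def U.distr_pair_fst)
    also have "\<dots> = distr (R i) borel fst"
      by (subst distr_distr) (auto simp: R_def comp_def)
    finally show "\<mu> i = distr (R i) borel fst" .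
  qed
  have pointwise: "indicator {x. real m * (1 + \<alpha>) < N x} (\<Sum>i\<in>I. fst (r i))
      \<le> (\<Sum>j<m. indicator {x. 1 + \<alpha> < N x} (\<Sum>i\<in>I. part j (r i)) :: ennreal)"
    if r: "r \<in> space (Pi\<^sub>M I R)" for r
  proof (cases "\<exists>j<m. 1 + \<alpha> < N (\<Sum>i\<in>I. part j (r i))")
    case True
    then obtain j where "j < m" "1 + \<alpha> < N (\<Sum>i\<in>I. part j (r i))" by blast
    then have "(1::ennreal) \<le> (\<Sum>j<m. indicator {x. 1 + \<alpha> < N x} (\<Sum>i\<in>I. part j (r i)))"
      using member_le_sum[of j "{..<m}" "\<lambda>j. indicator {x. 1 + \<alpha> < N x} (\<Sum>i\<in>I. part j (r i)) :: ennreal"]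
      by simp
    then show ?thesis by (auto simp: indicator_def)
  next
    case False
    have "snd (r i) < m" if "i \<in> I" for i
      using r that by (auto simp: space_PiM R_def space_pair_measure space_U PiE_iff)
    then have "(\<Sum>i\<in>I. fst (r i)) = (\<Sum>i\<in>I. \<Sum>j<m. part j (r i))"
      by (intro sum.cong) (auto simp: part_def)
    also have "\<dots> = (\<Sum>j<m. \<Sum>i\<in>I. part j (r i))" by (rule sum.swap)
    finally have "N (\<Sum>i\<in>I. fst (r i)) \<le> (\<Sum>j<m. N (\<Sum>i\<in>I. part j (r i)))"
      using N_sum_le by simp
    also have "\<dots> \<le> (\<Sum>j<m. 1 + \<alpha>)" using False by (intro sum_mono) (meson lessThan_iff not_less)
    finally show ?thesis by (simp add: indicator_def)
  qed
  have "sum_expectation \<mu> (\<lambda>x. x) I (indicator {x. real m * (1 + \<alpha>) < N x})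
      = sum_expectation R fst I (indicator {x. real m * (1 + \<alpha>) < N x})"
    unfolding \<mu>_R by (rule sum_expectation_distr[where h = "\<lambda>x. x", OF I fsts]) measurable
  also have "\<dots> \<le> (\<integral>\<^sup>+r. (\<Sum>j<m. indicator {x. 1 + \<alpha> < N x} (\<Sum>i\<in>I. part j (r i))) \<partial>Pi\<^sub>M I R)"
    unfolding sum_expectation_def by (intro nn_integral_mono pointwise)
  also have "\<dots> = (\<Sum>j<m. sum_expectation R (part j) I (indicator {x. 1 + \<alpha> < N x}))"
    unfolding sum_expectation_def
    by (intro nn_integral_sum measurable_compose[OF summand_laws.measurable_partial_sum[OF parts]]) measurable
  also have "\<dots> = (\<Sum>j<m. sum_expectation (T j) (\<lambda>x. x) I (indicator {x. 1 + \<alpha> < N x}))"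
    unfolding T_def by (intro sum.cong sum_expectation_distr[where h = "\<lambda>x. x", OF I parts, symmetric]) measurable
  also have "\<dots> \<le> (\<Sum>j<m. ennreal (16 / \<alpha>) * sum_expectation \<nu> (\<lambda>x. x) I (indicator {x. 1 < N x}))"
    using T_symmetric \<nu> T_dominated I \<alpha> by (intro sum_mono unit_domination) auto
  finally show ?thesis by simp
qed

section \<open>Convex sets as unit balls of seminorms\<close>

text \<open>
  The Minkowski functional. The ball inside \<open>K\<close> makes it finite and continuous, and closedness of \<open>K\<close>
  makes the closed unit ball equal to \<open>K\<close> itself.
\<close>

lemma seminorm_of_convex_neighbourhood:
  fixes K :: "'a::{banach, second_countable_topology} set"
  assumes K: "closed K" "convex K" "\<And>x. x \<in> K \<Longrightarrow> - x \<in> K" and e: "0 < e" "cball 0 e \<subseteq> K"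
  obtains N where "continuous_seminorm N" "\<And>x. N x \<le> 1 \<longleftrightarrow> x \<in> K"
proof
  define S where "S x = {t. 0 < t \<and> (1 / t) *\<^sub>R x \<in> K}" for x
  define N where "N x = Inf (S x)" for x
  have S_bdd: "bdd_below (S x)" for x unfolding S_def by (rule bdd_belowI[of _ 0]) auto
  have S_large: "t \<in> S x" if "0 < t" "norm x \<le> t * e" for t x
  proof -
    have "(1 / t) *\<^sub>R x \<in> cball 0 e" using that by (simp add: field_simps)
    then show ?thesis using e that by (auto simp: S_def)
  qed
  have S_up: "t \<in> S x" if "s \<in> S x" "s \<le> t" for s t x
  proof -
    have "0 \<in> K" using e by auto
    have s: "0 < s" "(1 / s) *\<^sub>R x \<in> K" using that by (auto simp: S_def)
    have "(s / t) *\<^sub>R ((1 / s) *\<^sub>R x) + (1 - s / t) *\<^sub>R 0 \<in> K"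
      using s that \<open>0 \<in> K\<close> by (intro convexD[OF K(2)]) auto
    then show ?thesis using s that by (simp add: S_def)
  qed
  have N_le: "N x \<le> t" if "t \<in> S x" for x t unfolding N_def using that S_bdd by (rule cInf_lower)
  have S_nonempty: "S x \<noteq> {}" for x
    using S_large[of "norm x / e + 1" x] e by (auto simp: field_simps add_pos_nonneg)
  have S_above: "t \<in> S x" if "N x < t" for x t
    using cInf_lessD[OF S_nonempty] that S_up unfolding N_def by (meson less_imp_le)
  have N_nonneg: "0 \<le> N x" for x
    unfolding N_def by (rule cInf_greatest[OF S_nonempty]) (auto simp: S_def)
  have N_le_I: "N x \<le> c" if "\<And>t. c < t \<Longrightarrow> t \<in> S x" for x c
    using N_le that by (meson dense_ge)
  have scale: "N (c *\<^sub>R x) \<le> c * N x" if "0 < c" for c x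
  proof (rule N_le_I)
    fix t assume "c * N x < t"
    then have t: "N x < t / c" using that by (simp add: field_simps)
    then have "t / c \<in> S x" by (rule S_above)
    then show "t \<in> S (c *\<^sub>R x)" using that by (auto simp: S_def zero_less_divide_iff)
  qed
  have scale_eq: "N (c *\<^sub>R x) = c * N x" if "0 < c" for c x
  proof (rule antisym[OF scale[OF that]])
    have "N ((1 / c) *\<^sub>R (c *\<^sub>R x)) \<le> (1 / c) * N (c *\<^sub>R x)" using that by (intro scale) simp
    then show "c * N x \<le> N (c *\<^sub>R x)" using that by (simp add: field_simps)
  qed
  have zero: "N 0 = 0"
    using scale_eq[of 2 0] by simp
  have minus: "N (- x) = N x" for x
  proof -
    have "(1 / t) *\<^sub>R (- x) \<in> K \<longleftrightarrow> (1 / t) *\<^sub>R x \<in> K" for t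
      using K(3)[of "(1 / t) *\<^sub>R x"] K(3)[of "(1 / t) *\<^sub>R (- x)"] by auto
    then show ?thesis unfolding N_def S_def by simp
  qed
  show "continuous_seminorm N"
  proof
    fix x y
    show "N (x + y) \<le> N x + N y"
    proof (rule N_le_I)
      fix t assume "N x + N y < t"
      define d where "d = (t - N x - N y) / 2"
      have d: "0 < d" "(N x + d) + (N y + d) = t" using \<open>N x + N y < t\<close> by (auto simp: d_def)
      let ?a = "N x + d" and ?b = "N y + d"
      have ab: "0 < ?a" "0 < ?b" using N_nonneg[of x] N_nonneg[of y] d by linarith+
      have "?a \<in> S x" "?b \<in> S y" using d by (auto intro: S_above)
      then have "(?a / t) *\<^sub>R ((1 / ?a) *\<^sub>R x) + (?b / t) *\<^sub>R ((1 / ?b) *\<^sub>R y) \<in> K"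
        using ab d by (intro convexD[OF K(2)]) (auto simp: S_def simp flip: add_divide_distrib)
      then have "(1 / t) *\<^sub>R (x + y) \<in> K" using ab by (simp add: scaleR_add_right)
      then show "t \<in> S (x + y)" using ab d by (simp add: S_def)
    qed
  next
    fix c x
    show "N (c *\<^sub>R x) = \<bar>c\<bar> * N x"
      using scale_eq[of c x] scale_eq[of "- c" x] zero minus[of "c *\<^sub>R x"]
      by (cases "c > 0"; cases "c = 0") auto
  next
    have "N x \<le> 1 / e * norm x" for x
    proof (rule N_le_I)
      fix t assume "1 / e * norm x < t"
      then show "t \<in> S x" using e
        by (intro S_large) (auto simp: field_simps intro: le_less_trans[OF _ \<open>1 / e * norm x < t\<close>])
    qed
    then show "\<exists>C. \<forall>x. N x \<le> C * norm x" by blast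
  qed
  show "N x \<le> 1 \<longleftrightarrow> x \<in> K" for x
  proof
    assume "x \<in> K"
    then show "N x \<le> 1" by (intro N_le) (simp add: S_def)
  next
    assume Nx: "N x \<le> 1"
    have "(1 / (1 + 1 / real (Suc k))) *\<^sub>R x \<in> K" for k
    proof -
      have "0 < 1 / real (Suc k)" by simp
      with Nx have "N x < 1 + 1 / real (Suc k)" by linarith
      then have "1 + 1 / real (Suc k) \<in> S x" by (rule S_above)
      then show ?thesis unfolding S_def by blast
    qed
    moreover have "(\<lambda>k. (1 / (1 + 1 / real (Suc k))) *\<^sub>R x) \<longlonglongrightarrow> (1 / (1 + 0)) *\<^sub>R x"
      by (intro tendsto_intros LIMSEQ_Suc[OF lim_1_over_n]) auto
    ultimately have "(1 / (1 + 0)) *\<^sub>R x \<in> K" by (rule closed_sequentially[OF K(1)])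
    then show "x \<in> K" by simp
  qed
qed

lemma convex_thickening:
  fixes K :: "'a::real_normed_vector set"
  assumes "convex K"
  shows "convex {x. infdist x K \<le> e}"
proof (cases "K = {}")
  case False
  show ?thesis
  proof (rule convexI)
    fix x y :: 'a and u v :: real
    assume uv: "0 \<le> u" "0 \<le> v" "u + v = 1"
      and xy: "x \<in> {x. infdist x K \<le> e}" "y \<in> {x. infdist x K \<le> e}"
    have "infdist (u *\<^sub>R x + v *\<^sub>R y) K \<le> d" if ed: "e < d" for d
    proof -
      obtain a where a: "a \<in> K" "dist x a < d"
        using xy(1) ed False infdist_notempty[OF False, of x] cInf_lessD[of "dist x ` K" d] by auto
      obtain b where b: "b \<in> K" "dist y b < d"
        using xy(2) ed False infdist_notempty[OF False, of y] cInf_lessD[of "dist y ` K" d] by auto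
      have "infdist (u *\<^sub>R x + v *\<^sub>R y) K \<le> dist (u *\<^sub>R x + v *\<^sub>R y) (u *\<^sub>R a + v *\<^sub>R b)"
        using convexD[OF assms a(1) b(1) uv] by (rule infdist_le)
      also have "\<dots> = norm (u *\<^sub>R (x - a) + v *\<^sub>R (y - b))"
        by (simp add: dist_norm algebra_simps)
      also have "\<dots> \<le> u * norm (x - a) + v * norm (y - b)"
        using norm_triangle_ineq[of "u *\<^sub>R (x - a)" "v *\<^sub>R (y - b)"] uv by simp
      also have "\<dots> \<le> u * d + v * d"
        using a b uv by (intro add_mono mult_left_mono) (auto simp: dist_norm)
      also have "\<dots> = d" using uv by (simp flip: distrib_right)
      finally show ?thesis .
    qed
    then show "u *\<^sub>R x + v *\<^sub>R y \<in> {x. infdist x K \<le> e}"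
      by (auto intro: dense_ge)
  qed
qed (simp add: infdist_def)

lemma infdist_uminus:
  fixes K :: "'a::real_normed_vector set"
  assumes "uminus ` K = K"
  shows "infdist (- x) K = infdist x K"
proof -
  have "dist (- x) ` K = dist (- x) ` (uminus ` K)" using assms by simp
  also have "\<dots> = dist x ` K" by (simp add: image_image dist_minus)
  finally show ?thesis by (simp add: infdist_def)
qed

section \<open>Domination of sums of random vectors\<close>

lemma sum_expectation_indep_vars:
  fixes X :: "'i \<Rightarrow> 'w \<Rightarrow> 'a::{banach, second_countable_topology}"
  assumes "prob_space M" and indep: "prob_space.indep_vars M (\<lambda>_. borel) X I"
    and law: "\<And>i. i \<in> I \<Longrightarrow> L i = distr M borel (X i)" and [measurable]: "F \<in> borel_measurable borel"
  shows "sum_expectation L (\<lambda>x. x) I F = (\<integral>\<^sup>+\<omega>. F (\<Sum>i\<in>I. X i \<omega>) \<partial>M)"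
proof -
  interpret prob_space M by fact
  have [measurable]: "i \<in> I \<Longrightarrow> X i \<in> borel_measurable M" for i
    using indep by (auto simp: indep_vars_def)
  show ?thesis
  proof (cases "I = {}")
    case True
    then show ?thesis by (simp add: emeasure_space_1)
  next
    case False
    have "Pi\<^sub>M I L = (\<Pi>\<^sub>M i\<in>I. distr M borel (X i))" using law by (intro PiM_cong) auto
    also have "\<dots> = distr M (\<Pi>\<^sub>M i\<in>I. borel) (\<lambda>\<omega>. \<lambda>i\<in>I. X i \<omega>)"
      using indep_vars_iff_distr_eq_PiM'[OF False, where M' = "\<lambda>_. borel" and X = X] indep by simp
    finally have "sum_expectation L (\<lambda>x. x) I F
        = (\<integral>\<^sup>+x. F (\<Sum>i\<in>I. x i) \<partial>distr M (\<Pi>\<^sub>M i\<in>I. borel) (\<lambda>\<omega>. \<lambda>i\<in>I. X i \<omega>))"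
      by (simp add: sum_expectation_def)
    also have "\<dots> = (\<integral>\<^sup>+\<omega>. F (\<Sum>i\<in>I. (\<lambda>i\<in>I. X i \<omega>) i) \<partial>M)"
      by (intro nn_integral_distr) measurable
    finally show ?thesis by simp
  qed
qed

lemma (in continuous_seminorm) continuous_seminorm_scale:
  assumes "0 \<le> c"
  shows "continuous_seminorm (\<lambda>x. c * N x)"
proof
  show "c * N (x + y) \<le> c * N x + c * N y" for x y
    using mult_left_mono[OF triangle assms] by (simp add: distrib_left)
  show "c * N (a *\<^sub>R x) = \<bar>a\<bar> * (c * N x)" for a x
    by (simp add: homogeneous)
  obtain C where "\<And>x. N x \<le> C * norm x" using bounded by blast
  then have "c * N x \<le> (c * C) * norm x" for x
    using mult_left_mono[OF _ assms] by (metis mult.assoc)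
  then show "\<exists>C. \<forall>x. c * N x \<le> C * norm x" by blast
qed

theorem theorem1:
  fixes M :: "'w measure"
    and X Y :: "nat \<Rightarrow> 'w \<Rightarrow> 'a::{banach, second_countable_topology}"
    and n :: nat and \<kappa> l \<alpha> :: real
  assumes "prob_space M"
    and "\<And>i. i \<in> {1..n} \<Longrightarrow> symmetric_rv M (X i)"
    and "\<And>i. i \<in> {1..n} \<Longrightarrow> symmetric_rv M (Y i)"
    and "prob_space.indep_vars M (\<lambda>_. borel) X {1..n}"
    and "prob_space.indep_vars M (\<lambda>_. borel) Y {1..n}"
    and "\<kappa> \<ge> 1" and "l \<ge> 1"
    and "\<And>i. i \<in> {1..n} \<Longrightarrow> dominated M \<kappa> l (X i) (Y i)"
    and "0 < \<alpha>" and "\<alpha> \<le> 1"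
  shows "dominated M (16 * inverse \<alpha> * real_of_int \<lceil>\<kappa>\<rceil>) ((1 + \<alpha>) * real_of_int \<lceil>\<kappa>\<rceil> * l)
           (\<lambda>\<omega>. \<Sum>i\<in>{1..n}. X i \<omega>) (\<lambda>\<omega>. \<Sum>i\<in>{1..n}. Y i \<omega>)"
proof -
  interpret prob_space M by fact
  define m where "m = nat \<lceil>\<kappa>\<rceil>"
  have m: "1 \<le> m" "\<kappa> \<le> real m" "real_of_int \<lceil>\<kappa>\<rceil> = real m"
    using \<open>\<kappa> \<ge> 1\<close> unfolding m_def by (auto simp: le_nat_iff real_nat_ceiling_ge)
  define I where "I = {1..n}"
  have X [measurable]: "X i \<in> borel_measurable M" and Y [measurable]: "Y i \<in> borel_measurable M"
    if "i \<in> I" for i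
    using assms(2,3)[of i] that by (auto simp: symmetric_rv_def I_def)
  \<comment> \<open>The laws are needed for all indices; outside \<open>I\<close> they are point masses at \<open>0\<close>.\<close>
  define \<mu> where "\<mu> i = (if i \<in> I then distr M borel (X i) else return borel 0)" for i
  define \<nu> where "\<nu> i = (if i \<in> I then distr M borel (\<lambda>\<omega>. l *\<^sub>R Y i \<omega>) else return borel 0)" for i
  have return_symmetric: "symmetric_law (return borel (0::'a))"
    unfolding symmetric_law_def by (auto simp: distr_return prob_space_return)
  have \<mu>_symmetric: "symmetric_law (\<mu> i)" for i
  proof (cases "i \<in> I")
    case True
    note [measurable] = X[OF True]
    have "distr (distr M borel (X i)) borel uminus = distr M borel (X i)"
      using assms(2)[of i] True by (subst distr_distr) (auto simp: comp_def symmetric_rv_def I_def)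
    then show ?thesis using True by (simp add: \<mu>_def symmetric_law_def prob_space_distr)
  qed (simp add: \<mu>_def return_symmetric)
  have \<nu>_symmetric: "symmetric_law (\<nu> i)" for i
  proof (cases "i \<in> I")
    case True
    note [measurable] = Y[OF True]
    have "distr (distr M borel (\<lambda>\<omega>. l *\<^sub>R Y i \<omega>)) borel uminus
        = distr (distr M borel (\<lambda>\<omega>. - Y i \<omega>)) borel (\<lambda>x. l *\<^sub>R x)"
      by (subst (1 2) distr_distr) (auto simp: comp_def)
    also have "\<dots> = distr (distr M borel (Y i)) borel (\<lambda>x. l *\<^sub>R x)"
      using assms(3)[of i] True by (simp add: symmetric_rv_def I_def)
    also have "\<dots> = distr M borel (\<lambda>\<omega>. l *\<^sub>R Y i \<omega>)"
      by (subst distr_distr) (auto simp: comp_def)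
    finally show ?thesis using True by (simp add: \<nu>_def symmetric_law_def prob_space_distr)
  qed (simp add: \<nu>_def return_symmetric)
  have law_dominated: "emeasure (\<mu> i) (- K) \<le> of_nat m * emeasure (\<nu> i) (- K)"
    if K: "closed K" "convex K" "uminus ` K = K" for i and K :: "'a set"
  proof (cases "i \<in> I")
    case True
    note [measurable] = X[OF True] Y[OF True]
    have [measurable]: "K \<in> sets borel" using K by (simp add: borel_closed)
    have "measure M {\<omega> \<in> space M. X i \<omega> \<notin> K} \<le> \<kappa> * measure M {\<omega> \<in> space M. l *\<^sub>R Y i \<omega> \<notin> K}"
      using assms(8)[of i] True K by (auto simp: dominated_def I_def)
    also have "\<dots> \<le> real m * measure M {\<omega> \<in> space M. l *\<^sub>R Y i \<omega> \<notin> K}"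
      using m by (intro mult_right_mono) auto
    finally have "ennreal (measure M {\<omega> \<in> space M. X i \<omega> \<notin> K})
        \<le> ennreal (real m * measure M {\<omega> \<in> space M. l *\<^sub>R Y i \<omega> \<notin> K})"
      by (rule ennreal_leI)
    then have "emeasure M {\<omega> \<in> space M. X i \<omega> \<notin> K} \<le> of_nat m * emeasure M {\<omega> \<in> space M. l *\<^sub>R Y i \<omega> \<notin> K}"
      by (simp add: emeasure_eq_measure ennreal_mult' ennreal_of_nat_eq_real_of_nat)
    moreover have "X i -` (- K) \<inter> space M = {\<omega> \<in> space M. X i \<omega> \<notin> K}"
      "(\<lambda>\<omega>. l *\<^sub>R Y i \<omega>) -` (- K) \<inter> space M = {\<omega> \<in> space M. l *\<^sub>R Y i \<omega> \<notin> K}" by auto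
    ultimately show ?thesis using True by (simp add: \<mu>_def \<nu>_def emeasure_distr)
  next
    case False
    have "1 * emeasure (return borel 0) (- K) \<le> of_nat m * emeasure (return borel 0) (- K)"
      using m by (intro mult_right_mono) auto
    then show ?thesis using False by (simp add: \<mu>_def \<nu>_def)
  qed
  have sum_X: "sum_expectation \<mu> (\<lambda>x. x) I F = (\<integral>\<^sup>+\<omega>. F (\<Sum>i\<in>I. X i \<omega>) \<partial>M)"
    if "F \<in> borel_measurable borel" for F
    using assms(1,4) that by (intro sum_expectation_indep_vars) (auto simp: \<mu>_def I_def)
  have sum_Y: "sum_expectation \<nu> (\<lambda>x. x) I F = (\<integral>\<^sup>+\<omega>. F (l *\<^sub>R (\<Sum>i\<in>I. Y i \<omega>)) \<partial>M)"
    if "F \<in> borel_measurable borel" for F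
  proof -
    have "indep_vars (\<lambda>_. borel) (\<lambda>i \<omega>. l *\<^sub>R Y i \<omega>) I"
      using indep_vars_compose2[OF assms(5), of "\<lambda>_ x. l *\<^sub>R x" "\<lambda>_. borel"] by (simp add: I_def)
    then show ?thesis
      using sum_expectation_indep_vars[OF assms(1), of "\<lambda>i \<omega>. l *\<^sub>R Y i \<omega>" I \<nu> F] that
      by (simp add: \<nu>_def scaleR_sum_right)
  qed

  define C where "C = 16 * inverse \<alpha> * real m"
  define c where "c = (1 + \<alpha>) * real m"
  have "0 < c" using m \<open>0 < \<alpha>\<close> by (simp add: c_def)
  have "1 \<le> C" using m \<open>0 < \<alpha>\<close> \<open>\<alpha> \<le> 1\<close>
    using mult_mono[of 1 "16 * inverse \<alpha>" 1 "real m"] by (simp add: C_def field_simps)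
  let ?SX = "\<lambda>\<omega>. \<Sum>i\<in>I. X i \<omega>" and ?SY = "\<lambda>\<omega>. \<Sum>i\<in>I. Y i \<omega>"
  have [measurable]: "?SX \<in> borel_measurable M" "?SY \<in> borel_measurable M" by measurable

  \<comment> \<open>The seminorm is rescaled by \<open>c\<close> because thinning compares the levels \<open>m (1 + \<alpha>) = c\<close> and \<open>1\<close>: after
    rescaling the set on the left is \<open>K\<close>, and the factor \<open>c\<close> moves into the sum on the right.\<close>
  have neighbourhood: "measure M {\<omega> \<in> space M. ?SX \<omega> \<notin> K} \<le> C * measure M {\<omega> \<in> space M. (c * l) *\<^sub>R ?SY \<omega> \<notin> K}"
    if K: "closed K" "convex K" "uminus ` K = K" and e: "0 < e" "cball 0 e \<subseteq> K" for K :: "'a set" and e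
  proof -
    have "- x \<in> K" if "x \<in> K" for x using K(3) that by blast
    then obtain N where N: "continuous_seminorm N" and N_K: "\<And>x. N x \<le> 1 \<longleftrightarrow> x \<in> K"
      using seminorm_of_convex_neighbourhood[OF K(1,2) _ e] by blast
    interpret N: continuous_seminorm N by (rule N)
    interpret cN: continuous_seminorm "\<lambda>x. c * N x"
      using \<open>0 < c\<close> by (intro N.continuous_seminorm_scale) simp
    have "sum_expectation \<mu> (\<lambda>x. x) I (indicator {x. real m * (1 + \<alpha>) < c * N x})
      \<le> of_nat m * (ennreal (16 / \<alpha>) * sum_expectation \<nu> (\<lambda>x. x) I (indicator {x. 1 < c * N x}))"
      by (rule cN.domination_by_thinning[OF \<mu>_symmetric \<nu>_symmetric law_dominated])
        (use m assms(9,10) in \<open>auto simp: I_def\<close>)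
    also have "sum_expectation \<mu> (\<lambda>x. x) I (indicator {x. real m * (1 + \<alpha>) < c * N x})
      = (\<integral>\<^sup>+\<omega>. indicator {\<omega> \<in> space M. ?SX \<omega> \<notin> K} \<omega> \<partial>M)"
    proof (subst sum_X)
      have "real m * (1 + \<alpha>) = c" by (simp add: c_def)
      then have "real m * (1 + \<alpha>) < c * N x \<longleftrightarrow> x \<notin> K" for x
        using mult_less_cancel_left_pos[OF \<open>0 < c\<close>, of 1 "N x"] N_K[of x] by auto
      then show "(\<integral>\<^sup>+\<omega>. indicator {x. real m * (1 + \<alpha>) < c * N x} (?SX \<omega>) \<partial>M)
          = (\<integral>\<^sup>+\<omega>. indicator {\<omega> \<in> space M. ?SX \<omega> \<notin> K} \<omega> \<partial>M)"
        by (intro nn_integral_cong) (auto simp: indicator_def)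
    qed measurable
    also have "sum_expectation \<nu> (\<lambda>x. x) I (indicator {x. 1 < c * N x})
      = (\<integral>\<^sup>+\<omega>. indicator {\<omega> \<in> space M. (c * l) *\<^sub>R ?SY \<omega> \<notin> K} \<omega> \<partial>M)"
    proof (subst sum_Y)
      have "1 < c * N (l *\<^sub>R x) \<longleftrightarrow> (c * l) *\<^sub>R x \<notin> K" for x
        using \<open>0 < c\<close> N.homogeneous[of c "l *\<^sub>R x"] N_K[of "(c * l) *\<^sub>R x"] by auto
      then show "(\<integral>\<^sup>+\<omega>. indicator {x. 1 < c * N x} (l *\<^sub>R ?SY \<omega>) \<partial>M)
          = (\<integral>\<^sup>+\<omega>. indicator {\<omega> \<in> space M. (c * l) *\<^sub>R ?SY \<omega> \<notin> K} \<omega> \<partial>M)"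
        by (intro nn_integral_cong) (auto simp: indicator_def)
    qed measurable
    finally have "emeasure M {\<omega> \<in> space M. ?SX \<omega> \<notin> K}
        \<le> of_nat m * (ennreal (16 / \<alpha>) * emeasure M {\<omega> \<in> space M. (c * l) *\<^sub>R ?SY \<omega> \<notin> K})"
      using K(1) borel_closed[of K] by simp
    also have "\<dots> = ennreal (C * measure M {\<omega> \<in> space M. (c * l) *\<^sub>R ?SY \<omega> \<notin> K})"
      using \<open>0 < \<alpha>\<close> by (simp add: C_def emeasure_eq_measure ennreal_of_nat_eq_real_of_nat field_simps flip: ennreal_mult')
    finally show ?thesis
      using \<open>1 \<le> C\<close> by (simp add: emeasure_eq_measure)
  qed

  have "measure M {\<omega> \<in> space M. ?SX \<omega> \<notin> K} \<le> C * measure M {\<omega> \<in> space M. (c * l) *\<^sub>R ?SY \<omega> \<notin> K}"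
    if K: "closed K" "convex K" "uminus ` K = K" for K :: "'a set"
  proof (cases "K = {}")
    case True
    then show ?thesis using \<open>1 \<le> C\<close> by (simp add: prob_space)
  next
    case False
    then have "0 \<in> K" using K zero_mem_symmetric_convex by blast
    have [measurable]: "K \<in> sets borel" using K by (simp add: borel_closed)
    \<comment> \<open>\<open>K\<close> may have empty interior; its thickenings are neighbourhoods of \<open>0\<close> that decrease to \<open>K\<close>.\<close>
    define thick where "thick k = {x. infdist x K \<le> 1 / real (Suc k)}" for k
    have thick_closed: "closed (thick k)" for k
      unfolding thick_def by (intro closed_Collect_le continuous_intros)
    have [measurable]: "thick k \<in> sets borel" for k using thick_closed by (simp add: borel_closed)
    have "K \<subseteq> thick k" for k by (auto simp: thick_def)
    define A where "A k = {\<omega> \<in> space M. ?SX \<omega> \<notin> thick k}" for k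
    have A_le: "measure M (A k) \<le> C * measure M {\<omega> \<in> space M. (c * l) *\<^sub>R ?SY \<omega> \<notin> K}" for k
    proof -
      have "measure M (A k) \<le> C * measure M {\<omega> \<in> space M. (c * l) *\<^sub>R ?SY \<omega> \<notin> thick k}"
        unfolding A_def
      proof (rule neighbourhood)
        show "uminus ` thick k = thick k"
        proof (intro equalityI subsetI)
          have minus_thick: "- x \<in> thick k" if "x \<in> thick k" for x
            using that by (simp add: thick_def infdist_uminus[OF K(3)])
          show "x \<in> thick k" if "x \<in> uminus ` thick k" for x
            using that minus_thick by auto
          show "x \<in> uminus ` thick k" if "x \<in> thick k" for x
            using imageI[OF minus_thick[OF that], of uminus] by simp
        qed
        show "cball 0 (1 / real (Suc k)) \<subseteq> thick k"
        proof
          fix x :: 'a assume "x \<in> cball 0 (1 / real (Suc k))"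
          then show "x \<in> thick k" using infdist_le[OF \<open>0 \<in> K\<close>, of x] by (simp add: thick_def)
        qed
      qed (use thick_closed K convex_thickening in \<open>auto simp: thick_def\<close>)
      also have "\<dots> \<le> C * measure M {\<omega> \<in> space M. (c * l) *\<^sub>R ?SY \<omega> \<notin> K}"
        using \<open>K \<subseteq> thick k\<close> \<open>1 \<le> C\<close> by (intro mult_left_mono finite_measure_mono) auto
      finally show ?thesis .
    qed
    have A_Union: "(\<Union>k. A k) = {\<omega> \<in> space M. ?SX \<omega> \<notin> K}"
    proof -
      have "\<exists>k. x \<notin> thick k" if "x \<notin> K" for x
      proof -
        have "0 < infdist x K" using in_closed_iff_infdist_zero[OF K(1) False, of x] that infdist_nonneg[of x K] by linarith
        then obtain k where "1 / real (Suc k) < infdist x K" using nat_approx_posE by blast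
        then show ?thesis by (auto simp: thick_def not_le)
      qed
      then show ?thesis using \<open>\<And>k. K \<subseteq> thick k\<close> by (auto simp: A_def)
    qed
    have "(\<lambda>k. measure M (A k)) \<longlonglongrightarrow> measure M (\<Union>k. A k)"
    proof (rule finite_Lim_measure_incseq)
      show "range A \<subseteq> sets M" unfolding A_def by auto
      show "incseq A"
      proof (rule incseq_SucI)
        fix k
        have "1 / real (Suc (Suc k)) \<le> 1 / real (Suc k)" by (simp add: frac_le)
        then have "thick (Suc k) \<subseteq> thick k" unfolding thick_def using order_trans by blast
        then show "A k \<subseteq> A (Suc k)" by (auto simp: A_def)
      qed
    qed
    then show ?thesis
      unfolding A_Union using A_le by (intro LIMSEQ_le_const2) auto
  qed
  then show ?thesis
    unfolding dominated_def m(3) C_def c_def I_def by simp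
qed

end
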